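(* Let $M$ be a monogenic inverse semigroup, i.e. an inverse semigroup generated, as an inverse semigroup, by a single element. Then $M$ has the semigroup Howson property if and only if $M$ is not free, i.e. if and only if $M$ is not isomorphic to the monogenic free inverse semigroup $FI_1$.
   Context: An inverse semigroup $M$ has the semigroup Howson property if the intersection of any two finitely generated (plain) subsemigroups of $M$ is finitely generated. Here a subsemigroup is a subset closed under multiplication (not necessarily closed under inverses), and finite generation is as a semigroup. The empty set is regarded as a finitely generated subsemigroup. $FI_1$ denotes the free inverse semigroup on one generator. It can be realised concretely as $$FI_1=\{(-a,x,b)\in\mathbb{Z}^3 : a,b\ge 0,\ a+b>0,\ -a\le x\le b\}$$ with multiplication $(-a_1,x_1,b_1)(-a_2,x_2,b_2)=(-\max(a_1,a_2-x_1),\,x_1+x_2,\,\max(b_1,b_2+x_1))$ and inverse $(-a,x,b)^{-1}=(-(a+x),-x,b-x)$; it is freely generated as an inverse semigroup by $(0,1,1)$. *)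

theory Defs
  imports Main
begin

locale inverse_semigroup =
  fixes M :: "'a set" and mult :: "'a \<Rightarrow> 'a \<Rightarrow> 'a" (infixl \<open>\<odot>\<close> 70)
  assumes closed: "\<lbrakk>x \<in> M; y \<in> M\<rbrakk> \<Longrightarrow> x \<odot> y \<in> M"
    and assoc: "\<lbrakk>x \<in> M; y \<in> M; z \<in> M\<rbrakk> \<Longrightarrow> (x \<odot> y) \<odot> z = x \<odot> (y \<odot> z)"
    and unique_inverse: "x \<in> M \<Longrightarrow> \<exists>!y. y \<in> M \<and> x \<odot> y \<odot> x = x \<and> y \<odot> x \<odot> y = y"

definition semigroup_inverse :: "'a set \<Rightarrow> ('a \<Rightarrow> 'a \<Rightarrow> 'a) \<Rightarrow> 'a \<Rightarrow> 'a" where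
  "semigroup_inverse M mult x =
     (THE y. y \<in> M \<and> mult (mult x y) x = x \<and> mult (mult y x) y = y)"

inductive_set inverse_semigroup_generated ::
    "'a set \<Rightarrow> ('a \<Rightarrow> 'a \<Rightarrow> 'a) \<Rightarrow> 'a set \<Rightarrow> 'a set"
  for M :: "'a set" and mult :: "'a \<Rightarrow> 'a \<Rightarrow> 'a" and X :: "'a set" where
  gen: "x \<in> X \<Longrightarrow> x \<in> inverse_semigroup_generated M mult X"
| mult: "\<lbrakk>x \<in> inverse_semigroup_generated M mult X; y \<in> inverse_semigroup_generated M mult X\<rbrakk>
    \<Longrightarrow> mult x y \<in> inverse_semigroup_generated M mult X"
| inverse: "x \<in> inverse_semigroup_generated M mult X
    \<Longrightarrow> semigroup_inverse M mult x \<in> inverse_semigroup_generated M mult X"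

definition monogenic_inverse_semigroup :: "'a set \<Rightarrow> ('a \<Rightarrow> 'a \<Rightarrow> 'a) \<Rightarrow> bool" where
  "monogenic_inverse_semigroup M mult \<longleftrightarrow>
     inverse_semigroup M mult \<and> (\<exists>g\<in>M. inverse_semigroup_generated M mult {g} = M)"

inductive_set semigroup_generated :: "('a \<Rightarrow> 'a \<Rightarrow> 'a) \<Rightarrow> 'a set \<Rightarrow> 'a set"
  for mult :: "'a \<Rightarrow> 'a \<Rightarrow> 'a" and X :: "'a set" where
  gen: "x \<in> X \<Longrightarrow> x \<in> semigroup_generated mult X"
| mult: "\<lbrakk>x \<in> semigroup_generated mult X; y \<in> semigroup_generated mult X\<rbrakk>
    \<Longrightarrow> mult x y \<in> semigroup_generated mult X"

text \<open>The empty set counts as a subsemigroup, and it is finitely generated (by the empty set).\<close>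

definition subsemigroup :: "'a set \<Rightarrow> ('a \<Rightarrow> 'a \<Rightarrow> 'a) \<Rightarrow> 'a set \<Rightarrow> bool" where
  "subsemigroup M mult T \<longleftrightarrow> T \<subseteq> M \<and> (\<forall>x\<in>T. \<forall>y\<in>T. mult x y \<in> T)"

definition finitely_generated_subsemigroup ::
    "'a set \<Rightarrow> ('a \<Rightarrow> 'a \<Rightarrow> 'a) \<Rightarrow> 'a set \<Rightarrow> bool" where
  "finitely_generated_subsemigroup M mult T \<longleftrightarrow>
     subsemigroup M mult T \<and> (\<exists>X. finite X \<and> X \<subseteq> T \<and> semigroup_generated mult X = T)"

definition semigroup_Howson :: "'a set \<Rightarrow> ('a \<Rightarrow> 'a \<Rightarrow> 'a) \<Rightarrow> bool" where
  "semigroup_Howson M mult \<longleftrightarrow>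
     (\<forall>T U. finitely_generated_subsemigroup M mult T \<and> finitely_generated_subsemigroup M mult U
        \<longrightarrow> finitely_generated_subsemigroup M mult (T \<inter> U))"

definition semigroup_isomorphic ::
    "'a set \<Rightarrow> ('a \<Rightarrow> 'a \<Rightarrow> 'a) \<Rightarrow> 'b set \<Rightarrow> ('b \<Rightarrow> 'b \<Rightarrow> 'b) \<Rightarrow> bool" where
  "semigroup_isomorphic M mult N mult' \<longleftrightarrow>
     (\<exists>f. bij_betw f M N \<and> (\<forall>x\<in>M. \<forall>y\<in>M. f (mult x y) = mult' (f x) (f y)))"

definition FI1 :: "(int \<times> int \<times> int) set" where
  "FI1 = {(- a, x, b) | a x b. a \<ge> 0 \<and> b \<ge> 0 \<and> a + b > 0 \<and> - a \<le> x \<and> x \<le> b}"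

text \<open>The first component of a triple is $-a$, so $-\max(a_1, a_2 - x_1)$ is rendered with
  $a_i = -p_i$.\<close>

fun FI1_mult :: "int \<times> int \<times> int \<Rightarrow> int \<times> int \<times> int \<Rightarrow> int \<times> int \<times> int" where
  "FI1_mult (p1, x1, b1) (p2, x2, b2) =
     (- max (- p1) (- p2 - x1), x1 + x2, max b1 (b2 + x1))"

lemma FI1_iff: "(p, x, b) \<in> FI1 \<longleftrightarrow> p \<le> 0 \<and> b \<ge> 0 \<and> p < b \<and> p \<le> x \<and> x \<le> b"
  unfolding FI1_def by (auto intro: exI[of _ "- p"])

lemma FI1_inverse_iff:
  assumes "(p, x, b) \<in> FI1" "(q, y, c) \<in> FI1"
  shows "FI1_mult (FI1_mult (p, x, b) (q, y, c)) (p, x, b) = (p, x, b) \<and>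
         FI1_mult (FI1_mult (q, y, c) (p, x, b)) (q, y, c) = (q, y, c) \<longleftrightarrow>
         (q, y, c) = (p - x, - x, b - x)"
  using assms by (auto simp: FI1_iff max_def split: if_splits)

lemma FI1_inverse_closed: "(p, x, b) \<in> FI1 \<Longrightarrow> (p - x, - x, b - x) \<in> FI1"
  by (auto simp: FI1_iff)

lemma inverse_semigroup_FI1: "inverse_semigroup FI1 FI1_mult"
proof
  fix s t u :: "int \<times> int \<times> int"
  show "FI1_mult s t \<in> FI1" if "s \<in> FI1" "t \<in> FI1"
    using that by (cases s; cases t) (auto simp: FI1_iff)
  show "FI1_mult (FI1_mult s t) u = FI1_mult s (FI1_mult t u)"
    by (cases s; cases t; cases u) (auto simp: max_def)
next
  fix s assume s: "s \<in> FI1"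
  obtain p x b where [simp]: "s = (p, x, b)" by (cases s)
  show "\<exists>!t. t \<in> FI1 \<and> FI1_mult (FI1_mult s t) s = s \<and> FI1_mult (FI1_mult t s) t = t"
  proof (rule ex1I[of _ "(p - x, - x, b - x)"])
    show "(p - x, - x, b - x) \<in> FI1 \<and>
        FI1_mult (FI1_mult s (p - x, - x, b - x)) s = s \<and>
        FI1_mult (FI1_mult (p - x, - x, b - x) s) (p - x, - x, b - x) = (p - x, - x, b - x)"
      using s FI1_inverse_closed[of p x b] FI1_inverse_iff[of p x b "p - x" "- x" "b - x"] by simp
  next
    fix t assume "t \<in> FI1 \<and> FI1_mult (FI1_mult s t) s = s \<and> FI1_mult (FI1_mult t s) t = t"
    then show "t = (p - x, - x, b - x)"
      using s FI1_inverse_iff[of p x b] unfolding \<open>s = (p, x, b)\<close> by (cases t) blast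
  qed
qed

lemma semigroup_inverse_FI1:
  assumes "(p, x, b) \<in> FI1"
  shows "semigroup_inverse FI1 FI1_mult (p, x, b) = (p - x, - x, b - x)"
  unfolding semigroup_inverse_def
proof (rule the_equality)
  show "(p - x, - x, b - x) \<in> FI1 \<and>
      FI1_mult (FI1_mult (p, x, b) (p - x, - x, b - x)) (p, x, b) = (p, x, b) \<and>
      FI1_mult (FI1_mult (p - x, - x, b - x) (p, x, b)) (p - x, - x, b - x) = (p - x, - x, b - x)"
    using assms FI1_inverse_closed FI1_inverse_iff by blast
next
  fix t assume "t \<in> FI1 \<and> FI1_mult (FI1_mult (p, x, b) t) (p, x, b) = (p, x, b) \<and>
      FI1_mult (FI1_mult t (p, x, b)) t = t"
  then show "t = (p - x, - x, b - x)"
    using assms FI1_inverse_iff by (cases t) blast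
qed

lemma FI1_generated: "inverse_semigroup_generated FI1 FI1_mult {(0, 1, 1)} = FI1"
proof
  let ?G = "inverse_semigroup_generated FI1 FI1_mult {(0, 1, 1)}"
  interpret inverse_semigroup FI1 FI1_mult by (rule inverse_semigroup_FI1)
  show "?G \<subseteq> FI1"
  proof
    fix s assume "s \<in> ?G"
    then show "s \<in> FI1"
    proof induction
      case (inverse t)
      obtain p x b where "t = (p, x, b)" by (cases t)
      with inverse show ?case
        using semigroup_inverse_FI1 FI1_inverse_closed by simp
    qed (auto simp: FI1_iff closed)
  qed
  have pow: "(0, int (Suc n), int (Suc n)) \<in> ?G" for n
  proof (induction n)
    case 0 then show ?case by (auto intro: inverse_semigroup_generated.gen)
  next
    case (Suc n)
    have "(0, 1, 1) \<in> ?G" by (auto intro: inverse_semigroup_generated.gen)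
    from inverse_semigroup_generated.mult[OF this Suc] show ?case by (simp add: algebra_simps)
  qed
  have P: "(0, k, k) \<in> ?G" if "k > 0" for k
    using pow[of "nat (k - 1)"] that by simp
  have N: "(- k, - k, 0) \<in> ?G" if "k > 0" for k
    using inverse_semigroup_generated.inverse[OF P[OF that]] that
    by (simp add: semigroup_inverse_FI1 FI1_iff)
  have L: "(- k, 0, 0) \<in> ?G" if "k > 0" for k
    using inverse_semigroup_generated.mult[OF N P, OF that that] that by simp
  show "FI1 \<subseteq> ?G"
  proof
    fix s assume s: "s \<in> FI1"
    obtain p x b where [simp]: "s = (p, x, b)" by (cases s)
    have sb: "p \<le> 0" "b \<ge> 0" "p < b" "p \<le> x" "x \<le> b" using s by (auto simp: FI1_iff)
    have 1: "(p, b, b) \<in> ?G"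
    proof (cases "p = 0 \<or> b = 0")
      case True then show ?thesis using P[of b] L[of "- p"] sb by auto
    next
      case False then show ?thesis
        using inverse_semigroup_generated.mult[OF L[of "- p"] P[of b]] sb by simp
    qed
    show "s \<in> ?G"
    proof (cases "x = b")
      case False then show ?thesis
        using inverse_semigroup_generated.mult[OF 1 N[of "b - x"]] sb by (simp add: max_def split: if_splits)
    qed (use 1 in simp)
  qed
qed

end

theory Submission
  imports Defs
begin

text \<open>A triple $(p, x, b)$ describes a walk on the integers from 0 to $x$ with range $[p, b]$.
  In $FI_1$ the minima can be controlled by parity: two finitely generated subsemigroups may
  meet only in walks with $p = 0$ and $x \ge 2$, where the infinitely many elements with $x = 2$ are
  all irreducible.

  In a proper quotient, sufficiently wide walks forget their minimum (or, after inverting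
  the generator, their maximum). A wide walk is then determined by its peak $b$ and its final fall
  $b - x$; multiplying on the left by an element with $x > 0$ raises the peak and keeps
  the fall, and multiplying on the right by one with $x < 0$ raises the fall and keeps the peak.
  By Dickson's lemma every subsemigroup with displacements of both signs is therefore finitely
  generated, and so is a subsemigroup with displacements $\ge 0$ and bounded falls. Bounded
  falls hold in each finitely generated subsemigroup without negative displacements, and in the
  intersection of two finitely generated subsemigroups having displacements of both signs, unless
  that intersection itself has displacements of both signs.\<close>

section \<open>Generated subsemigroups\<close>

lemma semigroup_generated_least:
  assumes "X \<subseteq> T" "\<And>x y. x \<in> T \<Longrightarrow> y \<in> T \<Longrightarrow> mult x y \<in> T"
  shows "semigroup_generated mult X \<subseteq> T"
proof
  fix x assume "x \<in> semigroup_generated mult X"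
  then show "x \<in> T" by induction (use assms in auto)
qed

lemma finitely_generated_subsemigroupI:
  assumes "S \<subseteq> M" "\<And>x y. x \<in> S \<Longrightarrow> y \<in> S \<Longrightarrow> mult x y \<in> S"
    and "finite X" "X \<subseteq> S" "S \<subseteq> semigroup_generated mult X"
  shows "finitely_generated_subsemigroup M mult S"
proof -
  have "semigroup_generated mult X = S"
    using assms semigroup_generated_least[of X S mult] by auto
  with assms show ?thesis
    unfolding finitely_generated_subsemigroup_def subsemigroup_def by blast
qed

lemma semigroup_generated_image:
  assumes "X \<subseteq> N" and closed: "\<And>x y. x \<in> N \<Longrightarrow> y \<in> N \<Longrightarrow> mult x y \<in> N"
    and hom: "\<And>x y. x \<in> N \<Longrightarrow> y \<in> N \<Longrightarrow> f (mult x y) = mult' (f x) (f y)"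
  shows "semigroup_generated mult' (f ` X) = f ` semigroup_generated mult X"
proof
  have N: "semigroup_generated mult X \<subseteq> N"
    using assms(1) closed by (rule semigroup_generated_least)
  show "semigroup_generated mult' (f ` X) \<subseteq> f ` semigroup_generated mult X"
  proof (rule semigroup_generated_least)
    fix x y assume "x \<in> f ` semigroup_generated mult X" "y \<in> f ` semigroup_generated mult X"
    then obtain u v where uv: "u \<in> semigroup_generated mult X" "v \<in> semigroup_generated mult X"
      "x = f u" "y = f v" by auto
    then have "mult' x y = f (mult u v)" using hom[of u v, symmetric] N by auto
    then show "mult' x y \<in> f ` semigroup_generated mult X"
      using semigroup_generated.mult[OF uv(1,2)] by simp
  qed (auto intro: semigroup_generated.gen)
  show "f ` semigroup_generated mult X \<subseteq> semigroup_generated mult' (f ` X)"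
  proof
    fix z assume "z \<in> f ` semigroup_generated mult X"
    then obtain u where "u \<in> semigroup_generated mult X" "z = f u" by auto
    from this(1) have "f u \<in> semigroup_generated mult' (f ` X)"
    proof induction
      case (mult x y)
      then have "f (mult x y) = mult' (f x) (f y)" using N by (intro hom) auto
      then show ?case using mult by (simp add: semigroup_generated.mult)
    qed (auto intro: semigroup_generated.gen)
    with \<open>z = f u\<close> show "z \<in> semigroup_generated mult' (f ` X)" by simp
  qed
qed

lemma finitely_generated_subsemigroup_image:
  assumes fg: "finitely_generated_subsemigroup N mult S"
    and into: "f ` N \<subseteq> M" and closed: "\<And>x y. x \<in> N \<Longrightarrow> y \<in> N \<Longrightarrow> mult x y \<in> N"
    and hom: "\<And>x y. x \<in> N \<Longrightarrow> y \<in> N \<Longrightarrow> f (mult x y) = mult' (f x) (f y)"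
  shows "finitely_generated_subsemigroup M mult' (f ` S)"
proof -
  from fg obtain X where X: "S \<subseteq> N" "\<forall>x\<in>S. \<forall>y\<in>S. mult x y \<in> S" "finite X" "X \<subseteq> S"
    "semigroup_generated mult X = S"
    unfolding finitely_generated_subsemigroup_def subsemigroup_def by blast
  have "semigroup_generated mult' (f ` X) = f ` S"
    using semigroup_generated_image[of X N mult f mult'] closed hom X by auto
  moreover have "mult' (f x) (f y) \<in> f ` S" if "x \<in> S" "y \<in> S" for x y
    using X that hom[of x y, symmetric] by auto
  ultimately show ?thesis
    using X into
    by (intro finitely_generated_subsemigroupI[of _ _ _ "f ` X"]) (auto simp: image_subset_iff subset_iff)
qed

text \<open>The two subsemigroups are pulled back along the inverse bijection \<open>i\<close>,
  intersected in \<open>M\<close> and pushed forward again; injectivity of \<open>i\<close> lets it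
  commute with the intersection.\<close>

lemma semigroup_Howson_isomorphic:
  assumes "semigroup_Howson M mult" "semigroup_isomorphic M mult N mult'"
    and closed: "\<And>x y. x \<in> M \<Longrightarrow> y \<in> M \<Longrightarrow> mult x y \<in> M"
  shows "semigroup_Howson N mult'"
  unfolding semigroup_Howson_def
proof (intro allI impI, elim conjE)
  fix T U assume T: "finitely_generated_subsemigroup N mult' T"
    and U: "finitely_generated_subsemigroup N mult' U"
  obtain f where f: "bij_betw f M N" "\<And>x y. x \<in> M \<Longrightarrow> y \<in> M \<Longrightarrow> f (mult x y) = mult' (f x) (f y)"
    using assms(2) unfolding semigroup_isomorphic_def by blast
  define i where "i = inv_into M f"
  have i: "i ` N \<subseteq> M" "\<And>y. y \<in> N \<Longrightarrow> f (i y) = y" "inj_on i N"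
    using f(1) bij_betw_inv_into[OF f(1)]
    by (auto simp: i_def bij_betw_def f_inv_into_f)
  have fN: "f ` M = N" and finj: "inj_on f M" using f(1) by (auto simp: bij_betw_def)
  have N_closed: "mult' x y \<in> N" if "x \<in> N" "y \<in> N" for x y
  proof -
    have "i x \<in> M" "i y \<in> M" using that i(1) by auto
    then have "mult' x y = f (mult (i x) (i y))" "mult (i x) (i y) \<in> M"
      using f(2)[of "i x" "i y"] closed i(2)[OF that(1)] i(2)[OF that(2)] by auto
    then show ?thesis using fN by auto
  qed
  have i_hom: "i (mult' x y) = mult (i x) (i y)" if "x \<in> N" "y \<in> N" for x y
  proof -
    have "i (f (mult (i x) (i y))) = mult (i x) (i y)"
      unfolding i_def using finj closed that i(1) by (intro inv_into_f_f) (auto simp: i_def)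
    moreover have "i x \<in> M" "i y \<in> M" using that i(1) by auto
    ultimately show ?thesis using that i(2) f(2)[of "i x" "i y"] by simp
  qed
  have "finitely_generated_subsemigroup M mult (i ` T)" "finitely_generated_subsemigroup M mult (i ` U)"
    using T U i(1) N_closed i_hom
    by (intro finitely_generated_subsemigroup_image[where f = i and N = N and mult = mult']; simp)+
  then have *: "finitely_generated_subsemigroup M mult (i ` T \<inter> i ` U)"
    using assms(1) unfolding semigroup_Howson_def by blast
  have TU: "T \<subseteq> N" "U \<subseteq> N"
    using T U by (auto simp: finitely_generated_subsemigroup_def subsemigroup_def)
  have "f ` (i ` T \<inter> i ` U) = T \<inter> U"
  proof -
    have "i ` T \<inter> i ` U = i ` (T \<inter> U)" using inj_on_image_Int[OF i(3) TU] by simp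
    moreover have "f ` i ` (T \<inter> U) = T \<inter> U" using i(2) TU by (force simp: image_image)
    ultimately show ?thesis by simp
  qed
  then show "finitely_generated_subsemigroup N mult' (T \<inter> U)"
    using finitely_generated_subsemigroup_image[where f = f and mult' = mult', OF * _ closed f(2), of N] fN
    by simp
qed

lemma semigroup_isomorphic_if_bij_hom:
  assumes "bij_betw f N M"
    and hom: "\<And>x y. x \<in> N \<Longrightarrow> y \<in> N \<Longrightarrow> f (mult' x y) = mult (f x) (f y)"
    and closed: "\<And>x y. x \<in> N \<Longrightarrow> y \<in> N \<Longrightarrow> mult' x y \<in> N"
  shows "semigroup_isomorphic M mult N mult'"
proof -
  define i where "i = inv_into N f"
  have i: "bij_betw i M N" unfolding i_def using assms(1) by (rule bij_betw_inv_into)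
  have "i (mult x y) = mult' (i x) (i y)" if "x \<in> M" "y \<in> M" for x y
  proof -
    have "i x \<in> N" "i y \<in> N" "f (i x) = x" "f (i y) = y"
      using that i assms(1) by (auto simp: i_def bij_betw_def f_inv_into_f inv_into_into)
    then have "mult x y = f (mult' (i x) (i y))" "mult' (i x) (i y) \<in> N" using hom closed by auto
    then show ?thesis using assms(1) unfolding i_def bij_betw_def by (simp add: inv_into_f_f)
  qed
  then show ?thesis using i unfolding semigroup_isomorphic_def by blast
qed


section \<open>The free case\<close>

lemma FI1_closed: "u \<in> FI1 \<Longrightarrow> v \<in> FI1 \<Longrightarrow> FI1_mult u v \<in> FI1"
  by (rule inverse_semigroup.closed[OF inverse_semigroup_FI1])

text \<open>In \<open>T\<close> the minimum is always even, in \<open>U\<close> it is odd unless it is 0.\<close>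

lemma not_semigroup_Howson_FI1: "\<not> semigroup_Howson FI1 FI1_mult"
proof
  assume Howson: "semigroup_Howson FI1 FI1_mult"
  let ?gen = "semigroup_generated FI1_mult"
  define T where "T = ?gen {(0, 2, 2), (- 2, - 2, 0)}"
  define U where "U = ?gen {(0, 2, 2), (- 3, - 2, 0)}"
  have T: "T \<subseteq> {(p, x, b) \<in> FI1. even p \<and> even x}"
    unfolding T_def
    by (rule semigroup_generated_least) (auto simp: FI1_iff max_def split: if_splits)
  \<comment> \<open>Displacements are even, so the minimum \<open>q + x\<close> reached during the
    second factor has the parity of \<open>q\<close>. If an odd \<open>q + x\<close> leaves the
    overall minimum at 0, then \<open>q + x \<ge> 1\<close>, and the even end point is at least
    2.\<close>
  have U: "U \<subseteq> {(p, x, b) \<in> FI1. even x \<and> (odd p \<or> p = 0 \<and> x \<ge> 2)}" (is "_ \<subseteq> ?U")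
    unfolding U_def
  proof (rule semigroup_generated_least)
    fix u v assume uv: "u \<in> ?U" "v \<in> ?U"
    obtain p x b q y c where "u = (p, x, b)" "v = (q, y, c)" by (cases u, cases v)
    moreover obtain i j where "x = 2 * i" "y = 2 * j"
      using uv calculation by (auto elim!: evenE)
    moreover have "(\<exists>k. p = 2 * k + 1) \<or> p = 0 \<and> i \<ge> 1" "(\<exists>k. q = 2 * k + 1) \<or> q = 0 \<and> j \<ge> 1"
      using uv calculation by (auto elim!: oddE)
    ultimately show "FI1_mult u v \<in> ?U"
      using uv by (auto simp: FI1_iff max_def) presburger+
  qed (auto simp: FI1_iff)
  have fg: "finitely_generated_subsemigroup FI1 FI1_mult (?gen X)" if "finite X" "X \<subseteq> FI1" for X
    using that semigroup_generated_least[OF that(2) FI1_closed]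
    by (intro finitely_generated_subsemigroupI[of _ _ _ X]) (auto intro: semigroup_generated.intros)
  have "finitely_generated_subsemigroup FI1 FI1_mult T" "finitely_generated_subsemigroup FI1 FI1_mult U"
    unfolding T_def U_def by (auto intro!: fg simp: FI1_iff)
  with Howson have "finitely_generated_subsemigroup FI1 FI1_mult (T \<inter> U)"
    unfolding semigroup_Howson_def by blast
  then obtain X where X: "finite X" "X \<subseteq> T \<inter> U" "?gen X = T \<inter> U"
    unfolding finitely_generated_subsemigroup_def by blast
  have X2: "\<forall>(p, x, b) \<in> X. x \<ge> 2"
    using X(2) T U by fastforce
  \<comment> \<open>A product of two elements of displacement at least 2 has displacement at least
    4, so an element of displacement 2 must itself be a generator.\<close>
  have gen_X: "?gen X \<subseteq> {u. (case u of (p, x, b) \<Rightarrow> x \<ge> 2) \<and> (fst (snd u) = 2 \<longrightarrow> u \<in> X)}"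
    using X2 by (intro semigroup_generated_least) auto
  have up: "(0, 2 * int (Suc n), 2 * int (Suc n)) \<in> ?gen {(0, 2, 2), v}" for n v
  proof (induction n)
    case 0 then show ?case by (auto intro: semigroup_generated.gen)
  next
    case (Suc n)
    have "(0, 2, 2) \<in> ?gen {(0, 2, 2), v}" by (auto intro: semigroup_generated.gen)
    from semigroup_generated.mult[OF this Suc] show ?case by simp
  qed
  \<comment> \<open>The overshoot \<open>d\<close> is 0 for the generator of \<open>T\<close> and 1
    for that of \<open>U\<close>; repeated descents overshoot only once, at the end.\<close>
  have down: "(- 2 * int (Suc n) - d, - 2 * int (Suc n), 0) \<in> ?gen {v, (- 2 - d, - 2, 0)}"
    if "d \<ge> 0" for n v d
  proof (induction n)
    case 0 then show ?case by (auto intro: semigroup_generated.gen)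
  next
    case (Suc n)
    have "(- 2 - d, - 2, 0) \<in> ?gen {v, (- 2 - d, - 2, 0)}" by (auto intro: semigroup_generated.gen)
    moreover have "FI1_mult (- 2 - d, - 2, 0) (- 2 * int (Suc n) - d, - 2 * int (Suc n), 0)
        = (- 2 * int (Suc (Suc n)) - d, - 2 * int (Suc (Suc n)), 0)"
      using that by simp
    ultimately show ?case using semigroup_generated.mult[OF _ Suc] by metis
  qed
  \<comment> \<open>Climb to \<open>2 * (n + 2)\<close>, then descend to 2. The lowest point of the
    descent is \<open>2 - d \<ge> 1\<close>, so the minimum stays 0 in both subsemigroups.\<close>
  have "(0, 2, 2 * int (Suc (Suc n))) \<in> X" for n
  proof -
    have "(0, 2, 2 * int (Suc (Suc n))) \<in> T"
      using semigroup_generated.mult[OF up[of "Suc n" "(- 2, - 2, 0)"] down[of 0 n "(0, 2, 2)", simplified]]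
      unfolding T_def by simp
    moreover have "(0, 2, 2 * int (Suc (Suc n))) \<in> U"
      using semigroup_generated.mult[OF up[of "Suc n" "(- 3, - 2, 0)"] down[of 1 n "(0, 2, 2)", simplified]]
      unfolding U_def by simp
    ultimately show ?thesis using gen_X X(3) by auto
  qed
  then have "range (\<lambda>n. (0::int, 2::int, 2 * int (Suc (Suc n)))) \<subseteq> X" by auto
  moreover have "inj (\<lambda>n. (0::int, 2::int, 2 * int (Suc (Suc n))))" by (auto simp: inj_def)
  ultimately show False
    using X(1) finite_subset finite_imageD infinite_UNIV_nat by metis
qed


section \<open>The homomorphism from the free monogenic inverse semigroup\<close>

context inverse_semigroup
begin

lemma inverse_eqI:
  assumes "x \<in> M" "y \<in> M" "x \<odot> y \<odot> x = x" "y \<odot> x \<odot> y = y"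
    and "z \<in> M" "x \<odot> z \<odot> x = x" "z \<odot> x \<odot> z = z"
  shows "y = z"
  using unique_inverse[OF assms(1)] assms(2-) by blast

text \<open>If \<open>x\<close> is the inverse of \<open>e \<odot> f\<close>, then so is
  \<open>f \<odot> x \<odot> e\<close>. By uniqueness they agree, which makes \<open>x\<close>
  idempotent. An idempotent is its own inverse, so \<open>x = e \<odot> f\<close>.\<close>

lemma idempotent_mult_idempotent:
  assumes e: "e \<in> M" "e \<odot> e = e" and f: "f \<in> M" "f \<odot> f = f"
  shows "(e \<odot> f) \<odot> (e \<odot> f) = e \<odot> f"
proof -
  obtain x where x: "x \<in> M" "(e \<odot> f) \<odot> x \<odot> (e \<odot> f) = e \<odot> f" "x \<odot> (e \<odot> f) \<odot> x = x"
    using unique_inverse[of "e \<odot> f"] e f closed by blast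
  have ee: "e \<odot> (e \<odot> z) = e \<odot> z" and ff: "f \<odot> (f \<odot> z) = f \<odot> z" if "z \<in> M" for z
    using that e f assoc by metis+
  have xefx: "x \<odot> (e \<odot> (f \<odot> x)) = x" using x e f by (simp add: assoc closed)
  have xefx': "x \<odot> (e \<odot> (f \<odot> (x \<odot> z))) = x \<odot> z" if "z \<in> M" for z
    using xefx e f x(1) that by (metis assoc closed)
  have "(e \<odot> f) \<odot> (f \<odot> x \<odot> e) \<odot> (e \<odot> f) = e \<odot> f"
    using x(2) e f x(1) by (simp add: assoc closed ee ff)
  moreover have "(f \<odot> x \<odot> e) \<odot> (e \<odot> f) \<odot> (f \<odot> x \<odot> e) = f \<odot> x \<odot> e"
    using e f x(1) by (simp add: assoc closed ee ff xefx')
  ultimately have x_eq: "x = f \<odot> x \<odot> e"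
    using x by (intro inverse_eqI[OF closed[OF e(1) f(1)] x(1)]) (simp_all add: closed e(1) f(1))
  have "(f \<odot> x \<odot> e) \<odot> (f \<odot> x \<odot> e) = f \<odot> x \<odot> e"
    using e f x(1) by (simp add: assoc closed xefx')
  then have xx: "x \<odot> x = x" by (simp only: x_eq[symmetric])
  then have "x = e \<odot> f"
    using x by (intro inverse_eqI[OF x(1) x(1)]) (simp_all add: closed e(1) f(1))
  with xx show ?thesis by simp
qed

text \<open>Both products are idempotent, so \<open>e \<odot> f\<close> has itself and also
  \<open>f \<odot> e\<close> as an inverse.\<close>

lemma idempotents_commute:
  assumes "e \<in> M" "e \<odot> e = e" "f \<in> M" "f \<odot> f = f"
  shows "e \<odot> f = f \<odot> e"
proof -
  have ef: "(e \<odot> f) \<odot> (e \<odot> f) = e \<odot> f" and fe: "(f \<odot> e) \<odot> (f \<odot> e) = f \<odot> e"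
    using idempotent_mult_idempotent assms by auto
  have ee: "e \<odot> (e \<odot> z) = e \<odot> z" and ff: "f \<odot> (f \<odot> z) = f \<odot> z" if "z \<in> M" for z
    using that assms assoc by metis+
  have "(e \<odot> f) \<odot> (f \<odot> e) \<odot> (e \<odot> f) = e \<odot> f"
    using ef assms by (simp add: assoc closed ee ff)
  moreover have "(f \<odot> e) \<odot> (e \<odot> f) \<odot> (f \<odot> e) = f \<odot> e"
    using fe assms by (simp add: assoc closed ee ff)
  ultimately show ?thesis
    using ef assms(1,3)
    by (intro inverse_eqI[OF closed[OF assms(1,3)] closed[OF assms(1,3)] _ _ closed[OF assms(3,1)]]) simp_all
qed

end

section \<open>Normal forms for products of a generator and its inverse\<close>

primrec monoid_power :: "('a \<Rightarrow> 'a \<Rightarrow> 'a) \<Rightarrow> 'a \<Rightarrow> 'a \<Rightarrow> nat \<Rightarrow> 'a" where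
  "monoid_power mult one x 0 = one"
| "monoid_power mult one x (Suc n) = mult x (monoid_power mult one x n)"

text \<open>The setting is a monoid with a generator \<open>g\<close>, its inverse \<open>h\<close>
  and commuting idempotents. The assumptions are symmetric in \<open>g\<close> and \<open>h\<close>,
  so every result has a dual in which \<open>up_down\<close> and \<open>down_up\<close> change
  places.\<close>

locale commuting_pair =
  fixes C :: "'a set" and mult :: "'a \<Rightarrow> 'a \<Rightarrow> 'a" (infixl \<open>\<odot>\<close> 70) and one g h :: 'a
  assumes closed: "x \<in> C \<Longrightarrow> y \<in> C \<Longrightarrow> x \<odot> y \<in> C"
    and assoc: "x \<in> C \<Longrightarrow> y \<in> C \<Longrightarrow> z \<in> C \<Longrightarrow> (x \<odot> y) \<odot> z = x \<odot> (y \<odot> z)"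
    and one: "one \<in> C" "x \<in> C \<Longrightarrow> one \<odot> x = x" "x \<in> C \<Longrightarrow> x \<odot> one = x"
    and gC: "g \<in> C" and hC: "h \<in> C"
    and ghg: "g \<odot> (h \<odot> g) = g" and hgh: "h \<odot> (g \<odot> h) = h"
    and comm: "e \<in> C \<Longrightarrow> f \<in> C \<Longrightarrow> e \<odot> e = e \<Longrightarrow> f \<odot> f = f \<Longrightarrow> e \<odot> f = f \<odot> e"
begin

abbreviation pw :: "'a \<Rightarrow> nat \<Rightarrow> 'a" where "pw \<equiv> monoid_power mult one"

abbreviation up_down :: "nat \<Rightarrow> 'a" where "up_down n \<equiv> pw g n \<odot> pw h n"

abbreviation down_up :: "nat \<Rightarrow> 'a" where "down_up n \<equiv> pw h n \<odot> pw g n"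

lemma dual: "commuting_pair C mult one h g"
  by unfold_locales (fact closed assoc one gC hC ghg hgh comm)+

lemma left_commute: "x \<in> C \<Longrightarrow> y \<in> C \<Longrightarrow> z \<in> C \<Longrightarrow> x \<odot> y = y \<odot> x \<Longrightarrow> x \<odot> (y \<odot> z) = y \<odot> (x \<odot> z)"
  by (metis assoc)

lemma pw_closed [simp]: "x \<in> C \<Longrightarrow> pw x n \<in> C"
  by (induction n) (auto simp: closed one)

lemmas C_simps = closed assoc one gC hC

lemma pw_Suc2: "x \<in> C \<Longrightarrow> pw x (Suc n) = pw x n \<odot> x"
  by (induction n) (simp_all add: closed one assoc[symmetric])

lemma up_down_Suc: "up_down (Suc n) = g \<odot> (up_down n \<odot> h)"
proof -
  have "up_down (Suc n) = (g \<odot> pw g n) \<odot> (pw h n \<odot> h)" using pw_Suc2[OF hC, of n] by simp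
  then show ?thesis by (simp add: C_simps)
qed

lemma hg_idem: "(h \<odot> g) \<odot> (h \<odot> g) = h \<odot> g"
  using ghg by (simp add: C_simps)

text \<open>In the induction the inner \<open>h \<odot> g\<close> commutes with the idempotent
  \<open>up_down n\<close> and is then absorbed by the outer \<open>g\<close>. The same move proves
  the next two lemmas.\<close>

lemma up_down_idem: "up_down n \<odot> up_down n = up_down n"
proof (induction n)
  case (Suc n)
  have c: "up_down n \<in> C" "h \<odot> g \<in> C" by (auto simp: C_simps)
  have "up_down (Suc n) \<odot> up_down (Suc n) = g \<odot> (up_down n \<odot> ((h \<odot> g) \<odot> (up_down n \<odot> h)))"
    unfolding up_down_Suc using c(1) by (simp only: C_simps)
  also have "\<dots> = g \<odot> ((h \<odot> g) \<odot> (up_down n \<odot> (up_down n \<odot> h)))"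
    using left_commute[OF c(1) c(2) closed[OF c(1) hC] comm[OF c Suc hg_idem]] by simp
  also have "\<dots> = (g \<odot> (h \<odot> g)) \<odot> ((up_down n \<odot> up_down n) \<odot> h)"
    using c(1) by (simp only: C_simps)
  also have "\<dots> = up_down (Suc n)" unfolding ghg Suc up_down_Suc by simp
  finally show ?case .
qed (simp add: one)

lemma g_up_down: "g \<odot> up_down n = up_down (Suc n) \<odot> g"
proof -
  have c: "up_down n \<in> C" "h \<odot> g \<in> C" by (auto simp: C_simps)
  have "up_down (Suc n) \<odot> g = g \<odot> (up_down n \<odot> (h \<odot> g))"
    unfolding up_down_Suc using c(1) by (simp only: C_simps)
  also have "\<dots> = g \<odot> ((h \<odot> g) \<odot> up_down n)"
    using comm[OF c up_down_idem hg_idem] by simp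
  also have "\<dots> = (g \<odot> (h \<odot> g)) \<odot> up_down n" using c(1) by (simp only: C_simps)
  finally show ?thesis unfolding ghg by simp
qed

lemma up_down_Suc_absorb: "up_down (Suc n) \<odot> up_down n = up_down (Suc n)"
proof (induction n)
  case (Suc n)
  have c: "up_down n \<in> C" "up_down (Suc n) \<in> C" "h \<odot> g \<in> C" by (auto simp: C_simps)
  have "up_down (Suc (Suc n)) \<odot> up_down (Suc n)
      = g \<odot> (up_down (Suc n) \<odot> ((h \<odot> g) \<odot> (up_down n \<odot> h)))"
    unfolding up_down_Suc[of "Suc n"] up_down_Suc[of n] using c(1) by (simp only: C_simps)
  also have "\<dots> = g \<odot> ((h \<odot> g) \<odot> (up_down (Suc n) \<odot> (up_down n \<odot> h)))"
    using left_commute[OF c(2) c(3) closed[OF c(1) hC] comm[OF c(2,3) up_down_idem hg_idem]] by simp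
  also have "\<dots> = (g \<odot> (h \<odot> g)) \<odot> ((up_down (Suc n) \<odot> up_down n) \<odot> h)"
    using c(1,2) by (simp only: C_simps)
  also have "\<dots> = up_down (Suc (Suc n))" unfolding ghg Suc up_down_Suc[of "Suc n"] by simp
  finally show ?case .
qed (simp add: C_simps)

lemma up_down_absorb: "m \<le> n \<Longrightarrow> up_down n \<odot> up_down m = up_down n"
proof (induction rule: dec_induct)
  case base then show ?case by (rule up_down_idem)
next
  case (step n)
  have c: "up_down n \<in> C" "up_down m \<in> C" "up_down (Suc n) \<in> C" by (auto simp: C_simps)
  have "up_down (Suc n) \<odot> up_down m = (up_down (Suc n) \<odot> up_down n) \<odot> up_down m"
    unfolding up_down_Suc_absorb ..
  also have "\<dots> = up_down (Suc n) \<odot> (up_down n \<odot> up_down m)" using c by (simp only: assoc)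
  finally show ?case unfolding step.IH up_down_Suc_absorb .
qed

lemma up_down_pw: "up_down n \<odot> pw g n = pw g n"
proof (induction n)
  case (Suc n)
  have c: "up_down n \<in> C" "up_down (Suc n) \<in> C" by (auto simp: C_simps)
  have "up_down (Suc n) \<odot> pw g (Suc n) = (up_down (Suc n) \<odot> g) \<odot> pw g n"
    using c(2) by (simp only: monoid_power.simps(2)[of mult one g n] assoc gC pw_closed)
  also have "\<dots> = g \<odot> (up_down n \<odot> pw g n)"
    unfolding g_up_down[symmetric] using c by (simp only: assoc gC pw_closed)
  finally show ?case unfolding Suc by simp
qed (simp add: one)

lemma up_down_commute_down_up: "up_down m \<odot> down_up n = down_up n \<odot> up_down m"
  by (rule comm) (auto simp: closed gC hC up_down_idem commuting_pair.up_down_idem[OF dual])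

lemma pw_down_up: "pw h n \<odot> (h \<odot> g) = down_up (Suc n) \<odot> pw h n"
proof (induction n)
  case (Suc n)
  have c: "down_up (Suc n) \<in> C" "down_up (Suc (Suc n)) \<in> C" by (auto simp: C_simps)
  have "pw h (Suc n) \<odot> (h \<odot> g) = h \<odot> (pw h n \<odot> (h \<odot> g))" by (simp add: C_simps)
  also have "\<dots> = (h \<odot> down_up (Suc n)) \<odot> pw h n" unfolding Suc using c by (simp only: assoc gC hC pw_closed)
  also have "\<dots> = down_up (Suc (Suc n)) \<odot> (h \<odot> pw h n)"
    using assoc[OF c(2) hC pw_closed[OF hC]] commuting_pair.g_up_down[OF dual, of "Suc n"]
    by (simp only:)
  finally show ?case by (simp only: monoid_power.simps(2)[of mult one h])
qed (simp add: C_simps)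

text \<open>The normal form of the walk: down to \<open>p\<close> and back, up to \<open>b\<close>
  and back, then straight to \<open>x\<close>.\<close>

definition path_value :: "int \<times> int \<times> int \<Rightarrow> 'a" where
  "path_value = (\<lambda>(p, x, b). down_up (nat (- p)) \<odot>
     (up_down (nat b) \<odot> (if x \<ge> 0 then pw g (nat x) else pw h (nat (- x)))))"

text \<open>Three situations occur. Below the peak, a nonnegative power of \<open>g\<close> just
  grows. At the peak, the new \<open>up_down (b + 1)\<close> can be put before
  \<open>g^(b + 1)\<close> and absorbs \<open>up_down b\<close>. Left of 0, the step turns
  \<open>h^(n + 1)\<close> into \<open>h^n\<close> and leaves an idempotent that the descent to
  \<open>p\<close> absorbs.\<close>

lemma path_value_mult_g:
  assumes "p \<le> 0" "b \<ge> 0" "p \<le> x" "x \<le> b"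
  shows "path_value (p, x + 1, max b (x + 1)) = path_value (p, x, b) \<odot> g"
proof -
  define D U where "D = down_up (nat (- p))" and "U = up_down (nat b)"
  have c: "D \<in> C" "U \<in> C" by (auto simp: D_def U_def C_simps)
  show ?thesis
  proof (cases "x \<ge> 0")
    case True
    then have Suc_x: "nat (x + 1) = Suc (nat x)" by simp
    have "path_value (p, x, b) \<odot> g = D \<odot> (U \<odot> pw g (Suc (nat x)))"
      unfolding path_value_def using True c
      by (simp add: D_def[symmetric] U_def[symmetric] assoc closed gC pw_Suc2 del: monoid_power.simps)
    also have "\<dots> = path_value (p, x + 1, max b (x + 1))"
    proof (cases "x = b")
      case xb: True
      let ?V = "up_down (Suc (nat x))" and ?g = "pw g (Suc (nat x))"
      have V: "?V \<in> C" by (auto simp: C_simps)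
      have g: "?g \<in> C" using gC by (rule pw_closed)
      have "U \<odot> ?V = ?V"
        using comm[OF c(2) V] up_down_absorb[of "nat b" "Suc (nat x)"] up_down_idem xb
        by (simp add: U_def del: monoid_power.simps)
      then have "U \<odot> ?g = ?V \<odot> ?g"
        using assoc[OF c(2) V g] up_down_pw[of "Suc (nat x)"] by (simp del: monoid_power.simps)
      then show ?thesis
        unfolding path_value_def using True xb Suc_x
        by (simp add: D_def[symmetric] max_def del: monoid_power.simps)
    next
      case False
      then have "max b (x + 1) = b" using assms by simp
      then show ?thesis
        unfolding path_value_def using True Suc_x
        by (simp add: D_def[symmetric] U_def[symmetric] max_def del: monoid_power.simps)
    qed
    finally show ?thesis by simp
  next
    case False
    \<comment> \<open>Since \<open>x = -(n + 1)\<close>, the new end point is \<open>-n\<close>. For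
      \<open>n = 0\<close> the definition of \<open>path_value\<close> switches to powers of
      \<open>g\<close>, but both zeroth powers are \<open>one\<close>.\<close>
    define n where "n = nat (- x) - 1"
    have n: "nat (- x) = Suc n" "nat (- (x + 1)) = n" using False by (auto simp: n_def)
    have x1: "x + 1 \<ge> 0 \<longleftrightarrow> n = 0" "nat (x + 1) = 0" using False by (auto simp: n_def)
    let ?E = "down_up (Suc n)"
    have E: "?E \<in> C" by (auto simp: C_simps)
    have "D \<odot> ?E = D"
      unfolding D_def using assms False
      by (intro commuting_pair.up_down_absorb[OF dual]) (auto simp: n_def)
    have UE: "U \<odot> ?E = ?E \<odot> U" unfolding U_def by (rule up_down_commute_down_up)
    let ?h = "pw h n"
    have h: "?h \<in> C" using hC by (rule pw_closed)
    have "path_value (p, x, b) \<odot> g = (D \<odot> (U \<odot> (?h \<odot> h))) \<odot> g"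
      unfolding path_value_def using False
      by (simp add: D_def[symmetric] U_def[symmetric] n pw_Suc2[OF hC] del: monoid_power.simps)
    also have "\<dots> = D \<odot> (U \<odot> (?h \<odot> (h \<odot> g)))"
      using c h by (simp only: assoc closed gC hC)
    also have "\<dots> = D \<odot> (?E \<odot> (U \<odot> ?h))"
      unfolding pw_down_up left_commute[OF c(2) E h UE] ..
    also have "\<dots> = D \<odot> (U \<odot> ?h)"
      using assoc[OF c(1) E closed[OF c(2) h]] \<open>D \<odot> ?E = D\<close> by simp
    also have "\<dots> = path_value (p, x + 1, max b (x + 1))"
    proof -
      have "max b (x + 1) = b" using assms False by simp
      then show ?thesis
        unfolding path_value_def using n x1 by (simp add: D_def[symmetric] U_def[symmetric])
    qed
    finally show ?thesis by simp
  qed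
qed

text \<open>Exchanging \<open>g\<close> and \<open>h\<close> reflects the line at 0. The two
  idempotents then appear in the opposite order, and they commute.\<close>

lemma path_value_dual:
  "commuting_pair.path_value mult one h g (- b, - x, - p) = path_value (p, x, b)"
proof -
  have "up_down (nat b) \<odot> (down_up (nat (- p)) \<odot> z) = down_up (nat (- p)) \<odot> (up_down (nat b) \<odot> z)"
    if "z \<in> C" for z
    using that up_down_commute_down_up by (intro left_commute) (auto simp: C_simps)
  then show ?thesis
    unfolding path_value_def commuting_pair.path_value_def[OF dual] by (auto simp: gC hC one)
qed

lemma path_value_mult_h:
  assumes "p \<le> 0" "b \<ge> 0" "p \<le> x" "x \<le> b"
  shows "path_value (min p (x - 1), x - 1, b) = path_value (p, x, b) \<odot> h"
proof -
  have "- min p (x - 1) = max (- p) (- x + 1)" by auto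
  then show ?thesis
    using commuting_pair.path_value_mult_g[OF dual, of "- b" "- p" "- x"] assms
      path_value_dual[of b "x - 1" "min p (x - 1)"] path_value_dual[of b x p] by simp
qed

end

section \<open>Mapping the free object onto a monogenic inverse semigroup\<close>

text \<open>Inversion reverses products and exchanges the two generators, so the plain subsemigroup
  they generate is already closed under inverses.\<close>

lemma FI1_semigroup_generated: "semigroup_generated FI1_mult {(0, 1, 1), (- 1, - 1, 0)} = FI1"
  (is "?G = FI1")
proof
  interpret inverse_semigroup FI1 FI1_mult by (rule inverse_semigroup_FI1)
  show G: "?G \<subseteq> FI1"
  proof
    fix u assume "u \<in> ?G" then show "u \<in> FI1" by induction (auto simp: FI1_iff closed)
  qed
  have inv: "(fst u - fst (snd u), - fst (snd u), snd (snd u) - fst (snd u)) \<in> ?G" if "u \<in> ?G" for u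
    using that
  proof induction
    case (mult u v)
    have "(fst (FI1_mult u v) - fst (snd (FI1_mult u v)), - fst (snd (FI1_mult u v)),
        snd (snd (FI1_mult u v)) - fst (snd (FI1_mult u v))) =
      FI1_mult (fst v - fst (snd v), - fst (snd v), snd (snd v) - fst (snd v))
        (fst u - fst (snd u), - fst (snd u), snd (snd u) - fst (snd u))"
      by (cases u; cases v) (auto simp: max_def)
    with semigroup_generated.mult[OF mult(4) mult(3)] show ?case by simp
  qed (auto intro: semigroup_generated.gen)
  have "u \<in> ?G" if "u \<in> inverse_semigroup_generated FI1 FI1_mult {(0, 1, 1)}" for u
    using that
  proof induction
    case (inverse u)
    then have "u \<in> FI1" by (simp add: FI1_generated)
    then show ?case using inv[OF inverse(2)] semigroup_inverse_FI1 by (cases u) simp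
  qed (auto intro: semigroup_generated.intros)
  then show "FI1 \<subseteq> ?G" using FI1_generated by blast
qed

text \<open>\<open>None\<close> is an adjoined identity, which makes room for powers with exponent 0.\<close>

fun option_mult :: "('a \<Rightarrow> 'a \<Rightarrow> 'a) \<Rightarrow> 'a option \<Rightarrow> 'a option \<Rightarrow> 'a option" where
  "option_mult mult None y = y"
| "option_mult mult x None = x"
| "option_mult mult (Some x) (Some y) = Some (mult x y)"

text \<open>This is the existence part of the universal property of \<open>FI1\<close>: walks are
  evaluated by \<open>path_value\<close> at the generator and its inverse.\<close>

lemma monogenic_FI1_hom:
  assumes "monogenic_inverse_semigroup M mult"
  shows "\<exists>f. f ` FI1 = M \<and> (\<forall>u\<in>FI1. \<forall>v\<in>FI1. f (FI1_mult u v) = mult (f u) (f v))"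
proof -
  obtain g where M: "inverse_semigroup M mult" and g: "g \<in> M" "inverse_semigroup_generated M mult {g} = M"
    using assms unfolding monogenic_inverse_semigroup_def by blast
  interpret inverse_semigroup M mult by (rule M)
  obtain h where h: "h \<in> M" "mult (mult g h) g = g" "mult (mult h g) h = h"
    using unique_inverse[OF g(1)] by blast
  let ?C = "insert None (Some ` M)" and ?m = "option_mult mult"
  have idem: "x = None \<or> (\<exists>e\<in>M. x = Some e \<and> mult e e = e)" if "x \<in> ?C" "?m x x = x" for x
    using that by auto
  interpret O: commuting_pair ?C ?m None "Some g" "Some h"
  proof
    fix e f assume "e \<in> ?C" "f \<in> ?C" "?m e e = e" "?m f f = f"
    then show "?m e f = ?m f e"
      using idem[of e] idem[of f] idempotents_commute by auto
  qed (use g h in \<open>auto simp: closed assoc\<close>)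
  let ?v = "O.path_value"
  have v_g: "?v (0, 1, 1) = Some g" and v_h: "?v (- 1, - 1, 0) = Some h"
    using g h by (auto simp: O.path_value_def)
  \<comment> \<open>Induction on the right factor, over plain semigroup generation: the rules for
    one step by \<open>g\<close> or \<open>h\<close> settle the generators, associativity the
    products.\<close>
  have hom: "?v (FI1_mult u v) = ?m (?v u) (?v v)"
    if "v \<in> semigroup_generated FI1_mult {(0, 1, 1), (- 1, - 1, 0)}" "u \<in> FI1" for u v
    using that
  proof (induction arbitrary: u)
    case (gen v)
    obtain p x b where u: "u = (p, x, b)" by (cases u)
    have "FI1_mult u (0, 1, 1) = (p, x + 1, max b (x + 1))"
      "FI1_mult u (- 1, - 1, 0) = (min p (x - 1), x - 1, b)"
      using gen u by (auto simp: FI1_iff)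
    moreover have "p \<le> 0" "b \<ge> 0" "p \<le> x" "x \<le> b" using gen u by (auto simp: FI1_iff)
    note O.path_value_mult_g[OF this] O.path_value_mult_h[OF this]
    ultimately show ?case
      using gen(1) v_g v_h unfolding u by (elim insertE emptyE) (simp_all only:)
  next
    case (mult v w)
    have vw: "v \<in> FI1" "w \<in> FI1" using mult(1,2) FI1_semigroup_generated by auto
    have c: "?v z \<in> ?C" for z
      unfolding O.path_value_def prod.case_distrib[of "\<lambda>m. m \<in> ?C"]
      using O.gC O.hC by (simp add: O.closed split: prod.split del: insert_iff)
    interpret F: inverse_semigroup FI1 FI1_mult by (rule inverse_semigroup_FI1)
    have "?v (FI1_mult u (FI1_mult v w)) = ?v (FI1_mult (FI1_mult u v) w)"
      using F.assoc[of u v w] vw mult.prems by simp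
    also have "\<dots> = ?m (?m (?v u) (?v v)) (?v w)"
      using mult.IH vw mult.prems F.closed by simp
    also have "\<dots> = ?m (?v u) (?v (FI1_mult v w))"
      using mult.IH(2)[of v] vw c O.assoc by simp
    finally show ?case .
  qed
  \<comment> \<open>No walk is sent to the adjoined identity, so \<open>the\<close> in the
    definition of \<open>f\<close> only strips \<open>Some\<close>.\<close>
  have some: "\<exists>m\<in>M. ?v u = Some m" if "u \<in> semigroup_generated FI1_mult {(0, 1, 1), (- 1, - 1, 0)}" for u
    using that
  proof induction
    case (mult u v)
    then show ?case using hom[of v u] FI1_semigroup_generated closed by auto
  qed (use v_g v_h g h in auto)
  define f where "f u = the (?v u)" for u
  have f: "f u \<in> M" "?v u = Some (f u)" if "u \<in> FI1" for u
    using some[of u] that FI1_semigroup_generated by (auto simp: f_def)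
  interpret F: inverse_semigroup FI1 FI1_mult by (rule inverse_semigroup_FI1)
  have f_hom: "f (FI1_mult u v) = mult (f u) (f v)" if "u \<in> FI1" "v \<in> FI1" for u v
    using hom[of v u] that f[of u] f[of v] f[of "FI1_mult u v"] F.closed FI1_semigroup_generated by auto
  have "m \<in> f ` FI1" if "m \<in> inverse_semigroup_generated M mult {g}" for m
    using that
  proof induction
    case (gen m)
    have "f (0, 1, 1) = m" using gen v_g by (simp add: f_def)
    then show ?case by (force simp: FI1_iff)
  next
    case (mult m n)
    then obtain u v where "u \<in> FI1" "v \<in> FI1" "m = f u" "n = f v" by auto
    then show ?case using f_hom F.closed by (intro image_eqI[of _ _ "FI1_mult u v"]) auto
  next
    \<comment> \<open>A homomorphism preserves both inverse equations, and inverses in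
      \<open>M\<close> are unique, so the image is closed under inversion.\<close>
    case (inverse m)
    then obtain u where u: "u \<in> FI1" "m = f u" by auto
    then obtain u' where u': "u' \<in> FI1" "FI1_mult (FI1_mult u u') u = u" "FI1_mult (FI1_mult u' u) u' = u'"
      using F.unique_inverse[OF u(1)] by blast
    have "mult (mult m (f u')) m = f (FI1_mult (FI1_mult u u') u)"
      "mult (mult (f u') m) (f u') = f (FI1_mult (FI1_mult u' u) u')"
      using u u'(1) by (simp_all add: f_hom F.closed)
    then have inv: "f u' \<in> M" "mult (mult m (f u')) m = m" "mult (mult (f u') m) (f u') = f u'"
      using u u' f by simp_all
    have "semigroup_inverse M mult m = f u'"
      unfolding semigroup_inverse_def
    proof (rule the_equality)
      fix y assume "y \<in> M \<and> mult (mult m y) m = m \<and> mult (mult y m) y = y"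
      then show "y = f u'"
        using inv f(1)[OF u(1)] u(2) inverse_eqI[of m y "f u'"] by simp
    qed (use inv in auto)
    then show ?case using u' by auto
  qed
  then have "f ` FI1 = M" using g f by auto
  then show ?thesis using f_hom by (intro exI[of _ f] conjI ballI)
qed


section \<open>A finiteness lemma\<close>

text \<open>Dickson's lemma in dimension two. Fix \<open>a\<close> in \<open>A\<close>; an element
  not above \<open>a\<close> has \<open>g\<close> below \<open>g a\<close> or \<open>h\<close> below
  \<open>h a\<close>, and for each of these finitely many values a minimiser of the other coordinate
  is kept.\<close>

lemma finite_minimal_nat_pairs:
  fixes A :: "'r set" and g h :: "'r \<Rightarrow> nat"
  shows "\<exists>F\<subseteq>A. finite F \<and> (\<forall>r\<in>A. \<exists>r'\<in>F. g r' \<le> g r \<and> h r' \<le> h r)"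
proof (cases "A = {}")
  case False
  then obtain a where a: "a \<in> A" by auto
  define G where "G n = (ARG_MIN h r. r \<in> A \<and> g r = n)" for n
  define H where "H n = (ARG_MIN g r. r \<in> A \<and> h r = n)" for n
  have G: "G (g r) \<in> A \<and> g (G (g r)) = g r \<and> h (G (g r)) \<le> h r" if "r \<in> A" for r
    using arg_min_natI[of "\<lambda>s. s \<in> A \<and> g s = g r" r h] arg_min_nat_le[of "\<lambda>s. s \<in> A \<and> g s = g r" r h] that
    by (simp add: G_def)
  have H: "H (h r) \<in> A \<and> h (H (h r)) = h r \<and> g (H (h r)) \<le> g r" if "r \<in> A" for r
    using arg_min_natI[of "\<lambda>s. s \<in> A \<and> h s = h r" r g] arg_min_nat_le[of "\<lambda>s. s \<in> A \<and> h s = h r" r g] that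
    by (simp add: H_def)
  \<comment> \<open>\<open>G n\<close> and \<open>H n\<close> are arbitrary when no element of
    \<open>A\<close> takes the value \<open>n\<close>; intersecting with \<open>A\<close> discards
    such junk.\<close>
  let ?F = "insert a ((G ` {..<g a} \<union> H ` {..<h a}) \<inter> A)"
  have "\<exists>r'\<in>?F. g r' \<le> g r \<and> h r' \<le> h r" if "r \<in> A" for r
  proof -
    consider "g a \<le> g r" "h a \<le> h r" | "g r < g a" | "h r < h a" by linarith
    then show ?thesis
    proof cases
      case 2
      then have "G (g r) \<in> ?F" using G[OF that] by auto
      then show ?thesis using G[OF that] by auto
    next
      case 3
      then have "H (h r) \<in> ?F" using H[OF that] by auto
      then show ?thesis using H[OF that] by auto
    qed auto
  qed
  then show ?thesis using a by (intro exI[of _ ?F]) auto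
qed auto

lemma finite_minimal_nat_pairs_classes:
  fixes A :: "'r set" and g h :: "'r \<Rightarrow> nat"
  assumes "finite (c ` A)"
  shows "\<exists>F\<subseteq>A. finite F \<and> (\<forall>r\<in>A. \<exists>r'\<in>F. c r' = c r \<and> g r' \<le> g r \<and> h r' \<le> h r)"
proof -
  have "\<exists>F\<subseteq>{r \<in> A. c r = k}. finite F \<and>
      (\<forall>r\<in>{r \<in> A. c r = k}. \<exists>r'\<in>F. g r' \<le> g r \<and> h r' \<le> h r)" for k
    by (rule finite_minimal_nat_pairs)
  then obtain F where "\<forall>k. F k \<subseteq> {r \<in> A. c r = k} \<and> finite (F k) \<and>
      (\<forall>r\<in>{r \<in> A. c r = k}. \<exists>r'\<in>F k. g r' \<le> g r \<and> h r' \<le> h r)"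
    using choice[of "\<lambda>k F. F \<subseteq> {r \<in> A. c r = k} \<and> finite F \<and>
      (\<forall>r\<in>{r \<in> A. c r = k}. \<exists>r'\<in>F. g r' \<le> g r \<and> h r' \<le> h r)"] by auto
  then have F: "F k \<subseteq> {r \<in> A. c r = k}" "finite (F k)"
    "\<forall>r\<in>{r \<in> A. c r = k}. \<exists>r'\<in>F k. g r' \<le> g r \<and> h r' \<le> h r" for k
    by blast+
  have "\<exists>r'\<in>(\<Union>k\<in>c ` A. F k). c r' = c r \<and> g r' \<le> g r \<and> h r' \<le> h r" if "r \<in> A" for r
  proof -
    have "\<exists>r'\<in>F (c r). g r' \<le> g r \<and> h r' \<le> h r" using that by (intro F(3)[THEN bspec]) auto
    then obtain r' where "r' \<in> F (c r)" "g r' \<le> g r" "h r' \<le> h r" by auto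
    then show ?thesis using F(1)[of "c r"] that by auto
  qed
  moreover have "(\<Union>k\<in>c ` A. F k) \<subseteq> A" using F(1) by auto
  moreover have "finite (\<Union>k\<in>c ` A. F k)" using assms F(2) by (rule finite_UN_I)
  ultimately show ?thesis by (intro exI[of _ "\<Union>k\<in>c ` A. F k"] conjI ballI)
qed

section \<open>Non-free quotients\<close>
definition disp :: "int \<times> int \<times> int \<Rightarrow> int" where "disp u = fst (snd u)"

definition peak :: "int \<times> int \<times> int \<Rightarrow> int" where "peak u = snd (snd u)"

definition fall :: "int \<times> int \<times> int \<Rightarrow> int" where "fall u = peak u - disp u"

definition width :: "int \<times> int \<times> int \<Rightarrow> int" where "width u = peak u - fst u"

lemmas walk_simps = disp_def peak_def fall_def width_def

lemma FI1_walk_bounds: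
  assumes "u \<in> FI1"
  shows "peak u \<ge> 0" "fall u \<ge> 0" "width u \<ge> peak u" "width u \<ge> fall u"
  using assms by (cases u; auto simp: FI1_iff walk_simps)+

lemma disp_mult: "disp (FI1_mult u v) = disp u + disp v"
  by (cases u; cases v) (simp add: disp_def)

lemma peak_mult: "peak (FI1_mult u v) = max (peak u) (peak v + disp u)"
  by (cases u; cases v) (simp add: walk_simps)

lemma fall_mult: "fall (FI1_mult u v) = max (fall u - disp v) (fall v)"
  by (cases u; cases v) (auto simp add: walk_simps max_def)

lemma width_mult: "width (FI1_mult u v) \<ge> width u" "width (FI1_mult u v) \<ge> width v"
  by (cases u; cases v; auto simp add: walk_simps max_def)+

text \<open>When \<open>fall s \<le> peak z\<close>, the peak of \<open>z\<close> dominates that of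
  \<open>s\<close> in the product, so the peak shifts by \<open>disp s\<close> and the fall is
  untouched. Raising the peak preserves this condition, so the step can be repeated.\<close>

lemma exists_raise:
  assumes G: "\<And>u v. u \<in> G \<Longrightarrow> v \<in> G \<Longrightarrow> FI1_mult u v \<in> G"
    and z: "z \<in> G" and s: "s \<in> G" "disp s \<ge> 0" "fall s \<le> peak z"
  shows "\<exists>z'\<in>G. peak z' = peak z + int n * disp s \<and> fall z' = fall z \<and> width z' \<ge> width z"
proof (induction n)
  case 0 then show ?case using z by auto
next
  case (Suc n)
  then obtain z' where z': "z' \<in> G" "peak z' = peak z + int n * disp s" "fall z' = fall z"
    "width z' \<ge> width z" by auto
  let ?z = "FI1_mult s z'"
  have ge: "peak z' \<ge> fall s" using z'(2) s by (simp add: add_increasing2)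
  have "peak ?z = peak z' + disp s"
    using ge unfolding peak_mult by (simp add: fall_def)
  moreover have "fall ?z = fall z'"
    using ge unfolding fall_mult by (simp add: fall_def)
  moreover have "width ?z \<ge> width z" using width_mult(2)[where u = s and v = z'] z'(4) by linarith
  ultimately show ?case using z' G[OF s(1) z'(1)] by (intro bexI[of _ ?z]) (auto simp: algebra_simps)
qed

text \<open>The counterpart on the right: once \<open>peak t \<le> fall z\<close>, appending
  \<open>t\<close> does not climb above the old peak, and the fall grows by
  \<open>- disp t\<close>.\<close>

lemma exists_lower:
  assumes G: "\<And>u v. u \<in> G \<Longrightarrow> v \<in> G \<Longrightarrow> FI1_mult u v \<in> G"
    and z: "z \<in> G" and t: "t \<in> G" "disp t \<le> 0" "peak t \<le> fall z"
  shows "\<exists>z'\<in>G. peak z' = peak z \<and> fall z' = fall z - int n * disp t \<and> width z' \<ge> width z"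
proof (induction n)
  case 0 then show ?case using z by auto
next
  case (Suc n)
  then obtain z' where z': "z' \<in> G" "peak z' = peak z" "fall z' = fall z - int n * disp t"
    "width z' \<ge> width z" by auto
  let ?z = "FI1_mult z' t"
  have "int n * disp t \<le> 0" using t(2) by (simp add: mult_nonneg_nonpos)
  then have ge: "fall z' \<ge> peak t" using z'(3) t by linarith
  have "peak ?z = peak z'"
    using ge unfolding peak_mult by (simp add: fall_def)
  moreover have "fall ?z = fall z' - disp t"
    using ge unfolding fall_mult by (simp add: fall_def)
  moreover have "width ?z \<ge> width z" using width_mult(1)[where u = z' and v = t] z'(4) by linarith
  ultimately show ?case using z' G[OF z'(1) t(1)] by (intro bexI[of _ ?z]) (auto simp: algebra_simps)
qed

lemma mod_eq_obtain_nat: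
  fixes x y d :: int
  assumes "x \<le> y" "x mod d = y mod d" "d > 0"
  obtains n :: nat where "y = x + int n * d"
proof -
  have "d dvd y - x" using assms(2) by (metis mod_eq_dvd_iff)
  then obtain j where j: "y - x = d * j" by (elim dvdE)
  have "0 \<le> d * j" using assms(1) by (simp flip: j)
  then have "0 \<le> j" using assms(3) by (simp add: zero_le_mult_iff)
  then show ?thesis using that[of "nat j"] j by (simp add: algebra_simps)
qed

text \<open>Every proper quotient of the free monogenic inverse semigroup, up to exchanging the generator
  with its inverse, satisfies the hypothesis \<open>forget\<close>: wide walks forget their minimum.\<close>

locale forgetful_image =
  fixes M :: "'a set" and mult :: "'a \<Rightarrow> 'a \<Rightarrow> 'a" and f :: "int \<times> int \<times> int \<Rightarrow> 'a" and k :: int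
  assumes image: "f ` FI1 = M"
    and hom: "\<And>u v. u \<in> FI1 \<Longrightarrow> v \<in> FI1 \<Longrightarrow> f (FI1_mult u v) = mult (f u) (f v)"
    and forget: "\<And>p x b. (p, x, b) \<in> FI1 \<Longrightarrow> b - p \<ge> k \<Longrightarrow> f (p - 1, x, b) = f (p, x, b)"
begin

lemma forget_minimum_nat:
  assumes "(p, x, b) \<in> FI1" "b - p \<ge> k"
  shows "f (p - int n, x, b) = f (p, x, b)"
proof (induction n)
  case (Suc n)
  have "(p - int n, x, b) \<in> FI1" "b - (p - int n) \<ge> k" using assms by (auto simp: FI1_iff)
  from forget[OF this] Suc show ?case by (simp add: algebra_simps)
qed simp

text \<open>Peak and fall determine the displacement, so only the minima can differ; lowering the
  higher one step by step keeps the walk wide.\<close>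

lemma wide_eq:
  assumes "u \<in> FI1" "v \<in> FI1" "width u \<ge> k" "width v \<ge> k" "peak u = peak v" "fall u = fall v"
  shows "f u = f v"
proof -
  obtain p x b q y c where uv: "u = (p, x, b)" "v = (q, y, c)" by (cases u, cases v)
  with assms have [simp]: "y = x" "c = b" by (auto simp: walk_simps)
  show ?thesis
  proof (cases "p \<le> q")
    case True
    with forget_minimum_nat[of q x b "nat (q - p)"] assms uv show ?thesis by (simp add: walk_simps)
  next
    case False
    with forget_minimum_nat[of p x b "nat (p - q)"] assms uv show ?thesis by (simp add: walk_simps)
  qed
qed

lemma preimage_closed:
  assumes "\<And>x y. x \<in> S \<Longrightarrow> y \<in> S \<Longrightarrow> mult x y \<in> S" "u \<in> FI1 \<inter> f -` S" "v \<in> FI1 \<inter> f -` S"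
  shows "FI1_mult u v \<in> FI1 \<inter> f -` S"
  using assms hom FI1_closed by auto

text \<open>The common finiteness criterion. \<open>R\<close> represents \<open>S\<close> by walks;
  \<open>B\<close> and \<open>C\<close> are thresholds from which peaks and falls can be raised by
  \<open>s\<close> and \<open>t\<close>, unless they stay below these thresholds on
  \<open>R\<close>. Generators are the images of the narrow walks in \<open>R\<close>, of finitely
  many minimal wide ones, and of \<open>s\<close> and \<open>t\<close> where these are used.\<close>

lemma finitely_generatedI:
  fixes d e :: nat
  assumes closed: "\<And>x y. x \<in> S \<Longrightarrow> y \<in> S \<Longrightarrow> mult x y \<in> S"
    and R: "R \<subseteq> FI1" "f ` R = S" and pos: "d > 0" "e > 0"
    and peak: "(\<forall>r\<in>R. peak r < B) \<or> (\<exists>s\<in>FI1. f s \<in> S \<and> disp s = int d \<and> fall s \<le> B)"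
    and fall: "(\<forall>r\<in>R. fall r < C) \<or> (\<exists>t\<in>FI1. f t \<in> S \<and> disp t = - int e \<and> peak t \<le> C)"
  shows "finitely_generated_subsemigroup M mult S"
proof -
  define W where "W = {r \<in> R. width r \<ge> k}"
  have "finite (R - W)"
  proof (rule finite_subset)
    show "R - W \<subseteq> {- k..0} \<times> {- k..k} \<times> {0..k}"
      using R(1) by (auto simp: W_def walk_simps FI1_iff)
  qed auto
  \<comment> \<open>Equal truncations mean that a coordinate either agrees or has reached its
    threshold in both walks; equal residues make the difference a multiple of \<open>d\<close> or
    \<open>e\<close>.\<close>
  define c where "c r = (min (peak r) B, min (fall r) C, peak r mod int d, fall r mod int e)" for r
  have "finite (c ` W)"
  proof (rule finite_subset)
    show "c ` W \<subseteq> {min 0 B..B} \<times> {min 0 C..C} \<times> {0..<int d} \<times> {0..<int e}"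
      using R(1) pos FI1_walk_bounds by (fastforce simp: c_def W_def min_def)
  qed auto
  from finite_minimal_nat_pairs_classes[OF this, of "\<lambda>r. nat (peak r)" "\<lambda>r. nat (fall r)"]
  obtain F where F: "F \<subseteq> W" "finite F"
    "\<And>r. r \<in> W \<Longrightarrow> \<exists>r'\<in>F. c r' = c r \<and> nat (peak r') \<le> nat (peak r) \<and> nat (fall r') \<le> nat (fall r)"
    by blast
  obtain Xs where Xs: "finite Xs" "Xs \<subseteq> S"
    "(\<forall>r\<in>R. peak r < B) \<or> (\<exists>s\<in>FI1. f s \<in> Xs \<and> disp s = int d \<and> fall s \<le> B)"
  proof (cases "\<forall>r\<in>R. peak r < B")
    case True then show ?thesis using that[of "{}"] by auto
  next
    case False
    with peak obtain s where "s \<in> FI1" "f s \<in> S" "disp s = int d" "fall s \<le> B" by auto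
    then show ?thesis using that[of "{f s}"] by auto
  qed
  obtain Xt where Xt: "finite Xt" "Xt \<subseteq> S"
    "(\<forall>r\<in>R. fall r < C) \<or> (\<exists>t\<in>FI1. f t \<in> Xt \<and> disp t = - int e \<and> peak t \<le> C)"
  proof (cases "\<forall>r\<in>R. fall r < C")
    case True then show ?thesis using that[of "{}"] by auto
  next
    case False
    with fall obtain t where "t \<in> FI1" "f t \<in> S" "disp t = - int e" "peak t \<le> C" by auto
    then show ?thesis using that[of "{f t}"] by auto
  qed
  define X where "X = f ` (R - W) \<union> f ` F \<union> Xs \<union> Xt"
  \<comment> \<open>Raising and lowering are carried out on walks, hence in the preimage of the
    generated subsemigroup.\<close>
  define G where "G = FI1 \<inter> f -` semigroup_generated mult X"
  have X_G: "u \<in> G" if "u \<in> FI1" "f u \<in> X" for u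
    using that by (auto simp: G_def intro: semigroup_generated.gen)
  have G_closed: "FI1_mult u v \<in> G" if "u \<in> G" "v \<in> G" for u v
    using that semigroup_generated.mult unfolding G_def by (intro preimage_closed) auto
  have "f r \<in> semigroup_generated mult X" if r: "r \<in> W" for r
  proof -
    have rR: "r \<in> R" "r \<in> FI1" "width r \<ge> k" using r R(1) by (auto simp: W_def)
    obtain r' where r': "r' \<in> F" "c r' = c r" "nat (peak r') \<le> nat (peak r)" "nat (fall r') \<le> nat (fall r)"
      using F(3)[OF r] by auto
    then have r'R: "r' \<in> R" "r' \<in> FI1" "width r' \<ge> k" using F(1) R(1) by (auto simp: W_def)
    have le: "peak r' \<le> peak r" "fall r' \<le> fall r"
      using r'(3,4) FI1_walk_bounds[OF rR(2)] FI1_walk_bounds[OF r'R(2)] by auto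
    have "r' \<in> G" using r'(1) r'R by (intro X_G) (auto simp: X_def)
    have cs: "min (peak r') B = min (peak r) B" "min (fall r') C = min (fall r) C"
      "peak r' mod int d = peak r mod int d" "fall r' mod int e = fall r mod int e"
      using r'(2) by (auto simp: c_def)
    \<comment> \<open>First the peak of the minimal walk \<open>r'\<close> is raised to that of
      \<open>r\<close> by left factors \<open>s\<close>; afterwards the fall is adjusted by right
      factors \<open>t\<close>. Widths never shrink, so \<open>wide_eq\<close> applies at the
      end.\<close>
    have "\<exists>z\<in>G. peak z = peak r \<and> fall z = fall r' \<and> width z \<ge> width r'"
    proof (cases "peak r' = peak r")
      case False
      then have "peak r' \<ge> B" "peak r \<ge> B" using cs(1) le(1) by (auto simp: min_def split: if_splits)
      then obtain s where s: "s \<in> FI1" "f s \<in> Xs" "disp s = int d" "fall s \<le> peak r'"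
        using Xs(3) rR(1) by force
      obtain n where "peak r = peak r' + int n * int d"
        using mod_eq_obtain_nat[OF le(1) cs(3)] pos by auto
      moreover have "s \<in> G" using s by (intro X_G) (auto simp: X_def)
      ultimately show ?thesis
        using exists_raise[OF G_closed \<open>r' \<in> G\<close> \<open>s \<in> G\<close>, of n] s by auto
    qed (use \<open>r' \<in> G\<close> in auto)
    then obtain z where z: "z \<in> G" "peak z = peak r" "fall z = fall r'" "width z \<ge> width r'" by auto
    have "\<exists>w\<in>G. peak w = peak r \<and> fall w = fall r \<and> width w \<ge> width z"
    proof (cases "fall r' = fall r")
      case False
      then have "fall r' \<ge> C" "fall r \<ge> C" using cs(2) le(2) by (auto simp: min_def split: if_splits)
      then obtain t where t: "t \<in> FI1" "f t \<in> Xt" "disp t = - int e" "peak t \<le> fall z"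
        using Xt(3) rR(1) z(3) by force
      obtain n where "fall r = fall r' + int n * int e"
        using mod_eq_obtain_nat[OF le(2) cs(4)] pos by auto
      moreover have "t \<in> G" using t by (intro X_G) (auto simp: X_def)
      ultimately show ?thesis
        using exists_lower[OF G_closed z(1) \<open>t \<in> G\<close>, of n] t z by auto
    qed (use z in auto)
    then obtain w where w: "w \<in> G" "peak w = peak r" "fall w = fall r" "width w \<ge> width z" by auto
    then have "f w = f r" using wide_eq[of w r] rR r'R z(4) by (auto simp: G_def)
    then show ?thesis using w(1) by (auto simp: G_def)
  qed
  moreover have "f r \<in> semigroup_generated mult X" if "r \<in> R - W" for r
    using that by (auto simp: X_def intro: semigroup_generated.gen)
  ultimately have "S \<subseteq> semigroup_generated mult X" using R(2) by blast
  moreover have "X \<subseteq> S" "S \<subseteq> M" using R F(1) Xs(2) Xt(2) image by (auto simp: X_def W_def)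
  moreover have "finite X" using \<open>finite (R - W)\<close> F(2) Xs(1) Xt(1) by (simp add: X_def)
  ultimately show ?thesis using closed by (intro finitely_generated_subsemigroupI)
qed

text \<open>An element \<open>s\<close> of positive displacement raises peaks from the threshold
  \<open>fall s\<close> on. If there is none, all displacements are 0, and peaks equal falls and are
  bounded by \<open>C\<close>.\<close>

lemma nonneg_finitely_generated:
  assumes closed: "\<And>x y. x \<in> S \<Longrightarrow> y \<in> S \<Longrightarrow> mult x y \<in> S"
    and R: "R \<subseteq> FI1" "f ` R = S" and bounds: "\<And>r. r \<in> R \<Longrightarrow> disp r \<ge> 0 \<and> fall r < C"
  shows "finitely_generated_subsemigroup M mult S"
proof (cases "\<exists>s\<in>R. disp s > 0")
  case True
  then obtain s where s: "s \<in> R" "disp s > 0" by auto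
  then show ?thesis
    using bounds R
    by (intro finitely_generatedI[OF closed R, of "nat (disp s)" 1 "fall s" C]) auto
next
  case False
  then have "disp r = 0" if "r \<in> R" for r using bounds[OF that] that by force
  then have "peak r < C" if "r \<in> R" for r using bounds[OF that] that by (simp add: fall_def)
  then show ?thesis
    using bounds by (intro finitely_generatedI[OF closed R, of 1 1 C C]) auto
qed

lemma nonpos_finitely_generated:
  assumes closed: "\<And>x y. x \<in> S \<Longrightarrow> y \<in> S \<Longrightarrow> mult x y \<in> S"
    and R: "R \<subseteq> FI1" "f ` R = S" and bounds: "\<And>r. r \<in> R \<Longrightarrow> disp r \<le> 0 \<and> peak r < C"
  shows "finitely_generated_subsemigroup M mult S"
proof (cases "\<exists>t\<in>R. disp t < 0")
  case True
  then obtain t where t: "t \<in> R" "disp t < 0" by auto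
  then show ?thesis
    using bounds R
    by (intro finitely_generatedI[OF closed R, of 1 "nat (- disp t)" C "peak t"]) auto
next
  case False
  then have "disp r = 0" if "r \<in> R" for r using bounds[OF that] that by force
  then have "fall r < C" if "r \<in> R" for r using bounds[OF that] that by (simp add: fall_def)
  then show ?thesis
    using bounds by (intro finitely_generatedI[OF closed R, of 1 1 C C]) auto
qed

text \<open>Here \<open>s\<close> raises peaks from \<open>fall s\<close> on and \<open>t\<close>
  raises falls from \<open>peak t\<close> on, with the whole preimage of \<open>S\<close> as
  representatives.\<close>

lemma two_sided_finitely_generated:
  assumes closed: "\<And>x y. x \<in> S \<Longrightarrow> y \<in> S \<Longrightarrow> mult x y \<in> S" and "S \<subseteq> M"
    and s: "s \<in> FI1" "f s \<in> S" "disp s > 0" and t: "t \<in> FI1" "f t \<in> S" "disp t < 0"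
  shows "finitely_generated_subsemigroup M mult S"
proof -
  have "f ` (FI1 \<inter> f -` S) = S" using \<open>S \<subseteq> M\<close> image by auto
  then show ?thesis
    using s t
    by (intro finitely_generatedI[OF closed, of "FI1 \<inter> f -` S" "nat (disp s)" "nat (- disp t)" "fall s" "peak t"])
      auto
qed

lemma finitely_generated_lift:
  assumes "finitely_generated_subsemigroup M mult T"
  obtains Y where "finite Y" "Y \<subseteq> FI1" "f ` semigroup_generated FI1_mult Y = T"
    "semigroup_generated FI1_mult Y \<subseteq> FI1"
proof -
  obtain X where X: "finite X" "X \<subseteq> M" "semigroup_generated mult X = T"
    using assms unfolding finitely_generated_subsemigroup_def subsemigroup_def by blast
  then obtain Y where Y: "Y \<subseteq> FI1" "finite Y" "X = f ` Y"
    using finite_subset_image[of X f FI1] image by auto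
  show ?thesis
    using that[of Y] Y X semigroup_generated_image[where f = f and mult' = mult, OF Y(1) FI1_closed hom]
      semigroup_generated_least[OF Y(1) FI1_closed] by auto
qed

section \<open>One-sided subsemigroups\<close>

text \<open>Without negative displacements the fall of a product is at most the larger fall of its
  factors, so the generators of \<open>T\<close> bound all falls on lifted representatives,
  including those of \<open>S\<close>.\<close>

lemma subsemigroup_of_nonneg_finitely_generated:
  assumes T: "finitely_generated_subsemigroup M mult T"
    and nonneg: "\<And>u. u \<in> FI1 \<Longrightarrow> f u \<in> T \<Longrightarrow> disp u \<ge> 0"
    and S: "S \<subseteq> T" "\<And>x y. x \<in> S \<Longrightarrow> y \<in> S \<Longrightarrow> mult x y \<in> S"
  shows "finitely_generated_subsemigroup M mult S"
proof -
  obtain Y where Y: "finite Y" "Y \<subseteq> FI1" "f ` semigroup_generated FI1_mult Y = T"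
    and G: "semigroup_generated FI1_mult Y \<subseteq> FI1"
    using finitely_generated_lift[OF T] by blast
  obtain C where C: "fall y \<le> C" if "y \<in> Y" for y
    using Y(1) finite_imageI[of Y fall] by (metis Max_ge imageI)
  have Y_nonneg: "disp y \<ge> 0" if "y \<in> Y" for y
    using nonneg[of y] Y(2,3) that semigroup_generated.gen[OF that] by auto
  have bounds: "disp u \<ge> 0 \<and> fall u \<le> C" if "u \<in> semigroup_generated FI1_mult Y" for u
    using that by induction (auto simp: disp_mult fall_mult C Y_nonneg)
  have "f ` (semigroup_generated FI1_mult Y \<inter> f -` S) = S" using Y(3) S(1) by auto
  then show ?thesis
    using bounds G
    by (intro nonneg_finitely_generated[OF S(2), of "semigroup_generated FI1_mult Y \<inter> f -` S" "C + 1"])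
      (auto simp: less_le_trans)
qed

lemma subsemigroup_of_nonpos_finitely_generated:
  assumes T: "finitely_generated_subsemigroup M mult T"
    and nonpos: "\<And>u. u \<in> FI1 \<Longrightarrow> f u \<in> T \<Longrightarrow> disp u \<le> 0"
    and S: "S \<subseteq> T" "\<And>x y. x \<in> S \<Longrightarrow> y \<in> S \<Longrightarrow> mult x y \<in> S"
  shows "finitely_generated_subsemigroup M mult S"
proof -
  obtain Y where Y: "finite Y" "Y \<subseteq> FI1" "f ` semigroup_generated FI1_mult Y = T"
    and G: "semigroup_generated FI1_mult Y \<subseteq> FI1"
    using finitely_generated_lift[OF T] by blast
  obtain C where C: "peak y \<le> C" if "y \<in> Y" for y
    using Y(1) finite_imageI[of Y peak] by (metis Max_ge imageI)
  have Y_nonpos: "disp y \<le> 0" if "y \<in> Y" for y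
    using nonpos[of y] Y(2,3) that semigroup_generated.gen[OF that] by auto
  have bounds: "disp u \<le> 0 \<and> peak u \<le> C" if "u \<in> semigroup_generated FI1_mult Y" for u
    using that by induction (auto simp: disp_mult peak_mult C Y_nonpos)
  have "f ` (semigroup_generated FI1_mult Y \<inter> f -` S) = S" using Y(3) S(1) by auto
  then show ?thesis
    using bounds G
    by (intro nonpos_finitely_generated[OF S(2), of "semigroup_generated FI1_mult Y \<inter> f -` S" "C + 1"])
      (auto simp: less_le_trans)
qed

section \<open>Intersections of two-sided subsemigroups\<close>

text \<open>Raising \<open>r\<close> by copies of \<open>s\<close> within \<open>T\<close> and by
  copies of \<open>s'\<close> within \<open>U\<close> reaches the same peak with the same fall, when
  the numbers of copies are the same multiple of \<open>disp s'\<close> and of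
  \<open>disp s\<close>. Wide walks with equal peak and fall have one image, which lies in
  both.\<close>

lemma common_raise:
  assumes T: "\<And>x y. x \<in> T \<Longrightarrow> y \<in> T \<Longrightarrow> mult x y \<in> T" and U: "\<And>x y. x \<in> U \<Longrightarrow> y \<in> U \<Longrightarrow> mult x y \<in> U"
    and r: "r \<in> FI1" "f r \<in> T \<inter> U" "width r \<ge> k"
    and s: "s \<in> FI1" "f s \<in> T" "disp s > 0" "fall s \<le> peak r"
    and s': "s' \<in> FI1" "f s' \<in> U" "disp s' > 0" "fall s' \<le> peak r"
  shows "\<exists>z\<in>FI1. f z \<in> T \<inter> U \<and> disp z > 0"
proof -
  \<comment> \<open>The displacement grows by at least \<open>m\<close>, which exceeds the absolute
    value of \<open>disp r\<close>, so it becomes positive.\<close>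
  define m where "m = nat (1 + \<bar>disp r\<bar>)"
  obtain z where z: "z \<in> FI1" "f z \<in> T" "peak z = peak r + int (m * nat (disp s')) * disp s"
    "fall z = fall r" "width z \<ge> width r"
    using exists_raise[OF preimage_closed[OF T], of r s "m * nat (disp s')"] r s by auto
  obtain z' where z': "z' \<in> FI1" "f z' \<in> U" "peak z' = peak r + int (m * nat (disp s)) * disp s'"
    "fall z' = fall r" "width z' \<ge> width r"
    using exists_raise[OF preimage_closed[OF U], of r s' "m * nat (disp s)"] r s' by auto
  have "peak z' = peak z" using z(3) z'(3) s(3) s'(3) by simp
  then have "f z' = f z" using wide_eq[of z' z] z z' r(3) by simp
  have "disp s' * disp s \<ge> 1" using s(3) s'(3) mult_mono[of 1 "disp s'" 1 "disp s"] by simp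
  then have "(1 + \<bar>disp r\<bar>) * 1 \<le> (1 + \<bar>disp r\<bar>) * (disp s' * disp s)"
    by (intro mult_left_mono) auto
  also have "\<dots> = disp z - disp r"
    using z(3,4) s'(3) by (simp add: m_def fall_def algebra_simps)
  finally have "1 + \<bar>disp r\<bar> \<le> disp z - disp r" by simp
  then have "disp z > 0" by linarith
  then show ?thesis using z z' \<open>f z' = f z\<close> by auto
qed

lemma common_lower:
  assumes T: "\<And>x y. x \<in> T \<Longrightarrow> y \<in> T \<Longrightarrow> mult x y \<in> T" and U: "\<And>x y. x \<in> U \<Longrightarrow> y \<in> U \<Longrightarrow> mult x y \<in> U"
    and r: "r \<in> FI1" "f r \<in> T \<inter> U" "width r \<ge> k"
    and t: "t \<in> FI1" "f t \<in> T" "disp t < 0" "peak t \<le> fall r"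
    and t': "t' \<in> FI1" "f t' \<in> U" "disp t' < 0" "peak t' \<le> fall r"
  shows "\<exists>z\<in>FI1. f z \<in> T \<inter> U \<and> disp z < 0"
proof -
  define m where "m = nat (1 + \<bar>disp r\<bar>)"
  obtain z where z: "z \<in> FI1" "f z \<in> T" "fall z = fall r - int (m * nat (- disp t')) * disp t"
    "peak z = peak r" "width z \<ge> width r"
    using exists_lower[OF preimage_closed[OF T], of r t "m * nat (- disp t')"] r t by auto
  obtain z' where z': "z' \<in> FI1" "f z' \<in> U" "fall z' = fall r - int (m * nat (- disp t)) * disp t'"
    "peak z' = peak r" "width z' \<ge> width r"
    using exists_lower[OF preimage_closed[OF U], of r t' "m * nat (- disp t)"] r t' by auto
  have "fall z' = fall z" using z(3) z'(3) t(3) t'(3) by simp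
  then have "f z' = f z" using wide_eq[of z' z] z z' r(3) by simp
  have "disp t' * disp t \<ge> 1" using t(3) t'(3) mult_mono[of 1 "- disp t'" 1 "- disp t"] by simp
  then have "(1 + \<bar>disp r\<bar>) * 1 \<le> (1 + \<bar>disp r\<bar>) * (disp t' * disp t)"
    by (intro mult_left_mono) auto
  also have "\<dots> = disp r - disp z"
    using z(3,4) t'(3) by (simp add: m_def fall_def algebra_simps)
  finally have "1 + \<bar>disp r\<bar> \<le> disp r - disp z" by simp
  then have "disp z < 0" by linarith
  then show ?thesis using z z' \<open>f z' = f z\<close> by auto
qed

theorem semigroup_Howson: "semigroup_Howson M mult"
  unfolding semigroup_Howson_def
proof (intro allI impI, elim conjE)
  fix T U assume T: "finitely_generated_subsemigroup M mult T"
    and U: "finitely_generated_subsemigroup M mult U"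
  have T_closed: "mult x y \<in> T" if "x \<in> T" "y \<in> T" for x y
    using T that by (auto simp: finitely_generated_subsemigroup_def subsemigroup_def)
  have U_closed: "mult x y \<in> U" if "x \<in> U" "y \<in> U" for x y
    using U that by (auto simp: finitely_generated_subsemigroup_def subsemigroup_def)
  let ?S = "T \<inter> U"
  have S_closed: "mult x y \<in> ?S" if "x \<in> ?S" "y \<in> ?S" for x y
    using that T_closed U_closed by auto
  have S_M: "?S \<subseteq> M"
    using T by (auto simp: finitely_generated_subsemigroup_def subsemigroup_def)
  note one_sided = subsemigroup_of_nonneg_finitely_generated[OF T _ _ S_closed]
    subsemigroup_of_nonneg_finitely_generated[OF U _ _ S_closed]
    subsemigroup_of_nonpos_finitely_generated[OF T _ _ S_closed]
    subsemigroup_of_nonpos_finitely_generated[OF U _ _ S_closed]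
  show "finitely_generated_subsemigroup M mult ?S"
  proof (rule ccontr)
    assume not_fg: "\<not> ?thesis"
    \<comment> \<open>If \<open>T\<close> lacked one of the signs, each of its subsemigroups would
      be finitely generated.\<close>
    obtain s t where s: "s \<in> FI1" "f s \<in> T" "disp s > 0" and t: "t \<in> FI1" "f t \<in> T" "disp t < 0"
      using one_sided(1,3) not_fg by (meson Int_lower1 not_le)
    obtain s' t' where s': "s' \<in> FI1" "f s' \<in> U" "disp s' > 0" and t': "t' \<in> FI1" "f t' \<in> U" "disp t' < 0"
      using one_sided(2,4) not_fg by (meson Int_lower2 not_le)
    \<comment> \<open>From \<open>B\<close> on, all four elements can act on a walk, and a peak of
      at least \<open>B\<close> forces width at least \<open>k\<close>.\<close>
    define B where "B = Max {k, fall s, fall s', peak t, peak t'}"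
    have B: "k \<le> B" "fall s \<le> B" "fall s' \<le> B" "peak t \<le> B" "peak t' \<le> B" by (auto simp: B_def)
    \<comment> \<open>A walk with both coordinates at least \<open>B\<close> would put displacements
      of both signs into the intersection and so make it finitely generated.\<close>
    have small: "peak r < B \<or> fall r < B" if r: "r \<in> FI1" "f r \<in> ?S" for r
    proof (rule ccontr)
      assume "\<not> ?thesis"
      then have r_B: "B \<le> peak r" "B \<le> fall r" by auto
      then have "width r \<ge> k" using B(1) FI1_walk_bounds[OF r(1)] by linarith
      have "fall s \<le> peak r" "fall s' \<le> peak r" "peak t \<le> fall r" "peak t' \<le> fall r"
        using B r_B by linarith+
      then obtain z w where "z \<in> FI1" "f z \<in> ?S" "disp z > 0" "w \<in> FI1" "f w \<in> ?S" "disp w < 0"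
        using common_raise[OF T_closed U_closed r \<open>width r \<ge> k\<close> s _ s']
          common_lower[OF T_closed U_closed r \<open>width r \<ge> k\<close> t _ t'] by auto
      with two_sided_finitely_generated[OF S_closed S_M] not_fg show False by blast
    qed
    have R: "FI1 \<inter> f -` ?S \<subseteq> FI1" "f ` (FI1 \<inter> f -` ?S) = ?S" using S_M image by auto
    consider "\<forall>r\<in>FI1 \<inter> f -` ?S. disp r \<ge> 0" | "\<forall>r\<in>FI1 \<inter> f -` ?S. disp r \<le> 0"
      using two_sided_finitely_generated[OF S_closed S_M] not_fg by (force simp: not_le)
    then show False
    proof cases
      case 1
      \<comment> \<open>With \<open>disp r \<ge> 0\<close> the fall is at most the peak, so either
        alternative of \<open>small\<close> bounds the fall.\<close>
      then have "disp r \<ge> 0 \<and> fall r < B" if "r \<in> FI1 \<inter> f -` ?S" for r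
        using that small[of r] by (force simp: fall_def)
      from nonneg_finitely_generated[OF S_closed R this] not_fg show False by blast
    next
      case 2
      then have "disp r \<le> 0 \<and> peak r < B" if "r \<in> FI1 \<inter> f -` ?S" for r
        using that small[of r] by (force simp: fall_def)
      from nonpos_finitely_generated[OF S_closed R this] not_fg show False by blast
    qed
  qed
qed

end

section \<open>Homomorphisms that are not injective\<close>

text \<open>The automorphism of \<open>FI1\<close> that exchanges the generator with its
  inverse.\<close>

definition mirror :: "int \<times> int \<times> int \<Rightarrow> int \<times> int \<times> int" where
  "mirror = (\<lambda>(p, x, b). (- b, - x, - p))"

lemma mirror_mirror [simp]: "mirror (mirror u) = u"
  by (cases u) (simp add: mirror_def)

lemma mirror_FI1 [simp]: "mirror u \<in> FI1 \<longleftrightarrow> u \<in> FI1"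
  by (cases u) (auto simp: mirror_def FI1_iff)

lemma mirror_mult: "mirror (FI1_mult u v) = FI1_mult (mirror u) (mirror v)"
  by (cases u; cases v) (auto simp: mirror_def max_def)

text \<open>Translating a coincidence \<open>f (p, x, b) = f (q, x, c)\<close> by suitable factors on both sides moves
  it to every walk that is at least as wide.\<close>

lemma forgetful_imageI:
  assumes image: "f ` FI1 = M"
    and hom: "\<And>u v. u \<in> FI1 \<Longrightarrow> v \<in> FI1 \<Longrightarrow> f (FI1_mult u v) = mult (f u) (f v)"
    and eq: "f (p, x, b) = f (q, x, c)" and pq: "p < q" and FI1: "(p, x, b) \<in> FI1" "(q, x, c) \<in> FI1"
  shows "\<exists>k. forgetful_image M mult f k"
proof -
  define N where "N = max b c + 1"
  have N: "N \<ge> 1" "b \<le> N" "c \<le> N" "x < N" "q \<le> 0" "q \<le> x" "p \<le> x" "p \<le> 0"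
    using FI1 by (auto simp: N_def FI1_iff)
  have cong: "f (FI1_mult w u) = f (FI1_mult w v)" "f (FI1_mult u w) = f (FI1_mult v w)"
    if "f u = f v" "u \<in> FI1" "v \<in> FI1" "w \<in> FI1" for u v w
    using that hom by auto
  \<comment> \<open>The left factor raises both maxima to \<open>N\<close> and leaves the minima
    alone.\<close>
  have "f (FI1_mult (0, 0, N) (p, x, b)) = f (FI1_mult (0, 0, N) (q, x, c))"
    using N by (intro cong(1)[OF eq FI1]) (auto simp: FI1_iff)
  then have N_eq: "f (p, x, N) = f (q, x, N)" using N by simp
  \<comment> \<open>Since \<open>p \<le> q - 1\<close>, the left walk is unchanged and the minimum
    of the right one drops to \<open>q - 1\<close>; the minima to be identified are now
    adjacent.\<close>
  have "f (FI1_mult (q - 1, 0, 0) (p, x, N)) = f (FI1_mult (q - 1, 0, 0) (q, x, N))"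
    using N by (intro cong(1)[OF N_eq]) (auto simp: FI1_iff)
  then have eq1: "f (q - 1, x, N) = f (q, x, N)" using N N_eq pq by (simp add: max_def)
  show ?thesis
  \<comment> \<open>The bound is the width of \<open>(q, x, N)\<close>: the shift by
    \<open>?d\<close> moves \<open>q\<close> to \<open>p'\<close>, and the shifted range then fits
    below \<open>b'\<close>.\<close>
  proof (intro exI[of _ "N - q"] forgetful_image.intro image hom)
    fix p' x' b' assume p': "(p', x', b') \<in> FI1" "N - q \<le> b' - p'"
    let ?d = "p' - q"
    have b: "p' \<le> 0" "b' \<ge> 0" "p' < b'" "p' \<le> x'" "x' \<le> b'" using p' by (auto simp: FI1_iff)
    have "f (FI1_mult (p', ?d, b') (q - 1, x, N)) = f (FI1_mult (p', ?d, b') (q, x, N))"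
      using N b p'(2) by (intro cong(1)[OF eq1]) (auto simp: FI1_iff)
    moreover have "FI1_mult (p', ?d, b') (q - 1, x, N) = (p' - 1, x + ?d, b')"
      "FI1_mult (p', ?d, b') (q, x, N) = (p', x + ?d, b')"
      using N b p'(2) by auto
    ultimately have eq2: "f (p' - 1, x + ?d, b') = f (p', x + ?d, b')" by (simp only:)
    \<comment> \<open>The right factor carries the end point from \<open>x + ?d\<close> to
      \<open>x'\<close> without leaving the range from \<open>p'\<close> to
      \<open>b'\<close>.\<close>
    have "f (FI1_mult (p' - 1, x + ?d, b') (p' - (x + ?d), x' - (x + ?d), b' - (x + ?d)))
        = f (FI1_mult (p', x + ?d, b') (p' - (x + ?d), x' - (x + ?d), b' - (x + ?d)))"
      using N b p'(2) by (intro cong(2)[OF eq2]) (auto simp: FI1_iff)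
    then show "f (p' - 1, x', b') = f (p', x', b')"
      using N b p'(2) by (simp add: max_def)
  qed
qed

text \<open>The map \<open>f'\<close> is \<open>f\<close> if a coincidence with equal displacements
  has different minima, and \<open>f \<circ> mirror\<close> if it has different maxima.\<close>

lemma non_injective_forgetful_image:
  assumes image: "f ` FI1 = M"
    and hom: "\<And>u v. u \<in> FI1 \<Longrightarrow> v \<in> FI1 \<Longrightarrow> f (FI1_mult u v) = mult (f u) (f v)"
    and "\<not> inj_on f FI1"
  shows "\<exists>f' k. forgetful_image M mult f' k"
proof -
  have "(f \<circ> mirror) ` FI1 = M"
    using image by (metis (no_types) image_comp image_eqI mirror_FI1 mirror_mirror subsetI subset_antisym image_subset_iff)
  note mirror_image = this
  have mirror_hom: "(f \<circ> mirror) (FI1_mult u v) = mult ((f \<circ> mirror) u) ((f \<circ> mirror) v)"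
    if "u \<in> FI1" "v \<in> FI1" for u v
    using that hom by (simp add: mirror_mult)
  have same_disp: ?thesis if eq: "f (p, x, b) = f (q, x, c)" "(p, x, b) \<in> FI1" "(q, x, c) \<in> FI1"
    and ne: "p \<noteq> q \<or> b \<noteq> c" for p q x b c
  proof -
    consider "p < q" | "q < p" | "c < b" | "b < c" using ne by linarith
    then show ?thesis
    proof cases
      case 1 then show ?thesis using forgetful_imageI[OF image hom eq(1)] eq by blast
    next
      case 2 then show ?thesis using forgetful_imageI[OF image hom eq(1)[symmetric]] eq by blast
    next
      case 3
      then show ?thesis
        using forgetful_imageI[OF mirror_image mirror_hom, of "- b" "- x" "- p" "- c" "- q"] eq
        by (auto simp: mirror_def FI1_iff)
    next
      case 4
      then show ?thesis
        using forgetful_imageI[OF mirror_image mirror_hom, of "- c" "- x" "- q" "- b" "- p"] eq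
        by (auto simp: mirror_def FI1_iff)
    qed
  qed
  obtain u v where uv: "u \<in> FI1" "v \<in> FI1" "f u = f v" "u \<noteq> v"
    using assms(3) unfolding inj_on_def by blast
  obtain p x b q y c where u: "u = (p, x, b)" and v: "v = (q, y, c)" by (cases u, cases v)
  show ?thesis
  proof (cases "x = y")
    case True
    then show ?thesis using same_disp uv u v by auto
  next
    case False
    text \<open>After widening both walks to a common range, the two orders of multiplication
      yield the same displacement but different ranges.\<close>
    define N where "N = max (max b c) (max (- p) (- q)) + 1"
    have N: "N > 0" "- N \<le> p" "- N \<le> q" "b \<le> N" "c \<le> N"
      "p \<le> 0" "q \<le> 0" "p \<le> x" "x \<le> b" "q \<le> y" "y \<le> c" "b \<ge> 0" "c \<ge> 0"
      using uv u v by (auto simp: N_def FI1_iff)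
    let ?w = "(- N, 0, N)"
    have w: "?w \<in> FI1" using N by (auto simp: FI1_iff)
    have wide: "FI1_mult ?w u = (- N, x, N)" "FI1_mult ?w v = (- N, y, N)"
      using N u v by (auto simp: max_def)
    have wide_FI1: "(- N, x, N) \<in> FI1" "(- N, y, N) \<in> FI1" using N by (auto simp: FI1_iff)
    have "f (- N, x, N) = f (- N, y, N)"
      using hom[OF w uv(1)] hom[OF w uv(2)] uv(3) wide by simp
    then have "f (FI1_mult (- N, x, N) (- N, y, N)) = f (FI1_mult (- N, y, N) (- N, x, N))"
      using hom[OF wide_FI1] hom[OF wide_FI1(2,1)] by (simp only:)
    moreover have "FI1_mult (- N, x, N) (- N, y, N) = (min (- N) (- N + x), x + y, max N (N + x))"
      "FI1_mult (- N, y, N) (- N, x, N) = (min (- N) (- N + y), x + y, max N (N + y))" by auto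
    moreover have "FI1_mult (- N, x, N) (- N, y, N) \<in> FI1" "FI1_mult (- N, y, N) (- N, x, N) \<in> FI1"
      using FI1_closed wide_FI1 by blast+
    \<comment> \<open>The two ranges determine \<open>min 0 x\<close> and \<open>max 0 x\<close>, or
      the same for \<open>y\<close>; their sum is the displacement, so equal ranges would force
      \<open>x = y\<close>.\<close>
    moreover have "min (- N) (- N + x) \<noteq> min (- N) (- N + y) \<or> max N (N + x) \<noteq> max N (N + y)"
      using False by (auto simp: min_def max_def)
    ultimately show ?thesis using same_disp by metis
  qed
qed

theorem theorem1:
  fixes M :: "'a set" and mult :: "'a \<Rightarrow> 'a \<Rightarrow> 'a"
  assumes "monogenic_inverse_semigroup M mult"
  shows "semigroup_Howson M mult \<longleftrightarrow> \<not> semigroup_isomorphic M mult FI1 FI1_mult"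
proof
  have closed: "mult x y \<in> M" if "x \<in> M" "y \<in> M" for x y
    using assms that inverse_semigroup.closed[of M mult x y]
    by (simp add: monogenic_inverse_semigroup_def)
  assume "semigroup_Howson M mult"
  then show "\<not> semigroup_isomorphic M mult FI1 FI1_mult"
    using semigroup_Howson_isomorphic[where M = M and mult = mult] closed not_semigroup_Howson_FI1 by blast
next
  assume not_iso: "\<not> semigroup_isomorphic M mult FI1 FI1_mult"
  obtain f where image: "f ` FI1 = M"
    and hom': "\<forall>u\<in>FI1. \<forall>v\<in>FI1. f (FI1_mult u v) = mult (f u) (f v)"
    using monogenic_FI1_hom[OF assms] by (elim exE conjE)
  have hom: "f (FI1_mult u v) = mult (f u) (f v)" if "u \<in> FI1" "v \<in> FI1" for u v
    using hom' that by simp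
  have "\<not> inj_on f FI1"
  proof
    assume "inj_on f FI1"
    then have "bij_betw f FI1 M" using image by (simp add: bij_betw_def)
    from semigroup_isomorphic_if_bij_hom[where mult' = FI1_mult, OF this hom FI1_closed] not_iso
    show False by blast
  qed
  from non_injective_forgetful_image[OF image hom this]
  obtain f' k where "forgetful_image M mult f' k" by blast
  then show "semigroup_Howson M mult" by (rule forgetful_image.semigroup_Howson)
qed

end
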